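(* Let $(K;\mathcal{T})$ be a triangulated 3-dimensional pseudo-manifold (with or without boundary) and let $(A,\kappa)$ be prescribed area-curvature functions with the property that $A\le 0$. (1) If $(K;\mathcal{T})$ admits a semi-angle structure with area-curvature $(A,\kappa)$, then $\chi^*(s)\le\chi^{(A,\kappa)}(s)$ for all $s\in C(K;\mathcal{T})$ with all quadrilateral coordinates non-negative. (2) If $(K;\mathcal{T})$ admits an angle structure with area-curvature $(A,\kappa)$, then $\chi^*(s)<\chi^{(A,\kappa)}(s)$ for all $s\in C(K;\mathcal{T})$ with all quadrilateral coordinates non-negative and at least one quadrilateral coordinate positive.
   Context: **Pseudo-manifolds.** Let $X$ be a disjoint union of compact 3-simplices $\sigma^3_1,\dots,\sigma^3_t$ and $\Phi=\{\phi_1,\dots,\phi_r\}$ a collection of affine isomorphisms $\phi_i:\tau_i\to\delta_i$ between distinct codimension-one faces of the simplices, with $\{\tau_i,\delta_i\}\cap\{\tau_j,\delta_j\}=\emptyset$ for $i\ne j$. The quotient $K=X/\Phi$ is a compact 3-dimensional pseudo-manifold and the images of the simplices and their sub-simplices form its triangulation $\mathcal{T}$, with cells called vertices, edges, triangles, tetrahedra. It has boundary (the images of unpaired faces) if some face is unpaired; otherwise it is closed. Let $e_1,\dots,e_n$ be the edges. **Normal disc types.** A normal disc in a tetrahedron is a properly embedded disc meeting each face in one normal arc (a properly embedded arc joining the interiors of two distinct edges of the face) or not at all. Up to normal isotopy (isotopy preserving each cell) each tetrahedron has four normal triangle types (each cutting off a corner and meeting the three edges there) and three normal quadrilateral types (each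 separating a pair of opposite edges and meeting the other four edges). A quadrilateral type faces the two edges of its tetrahedron disjoint from it. Let $N_\square=\{q_1,\dots,q_{3t}\}$ and $N_\Delta=\{p_1,\dots,p_{4t}\}$ be the sets of all quadrilateral and triangle types in $\mathcal{T}$. Identify these types with the standard basis vectors of $\mathbb{R}^{7t}$ (quadrilaterals first). **Solution space.** $C(K;\mathcal{T})\subset\mathbb{R}^{7t}$ is the vector space of all $(x_1,\dots,x_{3t},y_1,\dots,y_{4t})$ satisfying, for each pairing $\phi:\tau\to\delta$ in $\Phi$ (with $\tau\subset\sigma^3_i$, $\delta\subset\sigma^3_j$) and each normal arc type in the resulting triangle, $x_q+y_p=x_{q'}+y_{p'}$, where $q,p$ are the quadrilateral and triangle types in $\sigma^3_i$ meeting $\tau$ in that arc type and $q',p'$ those in $\sigma^3_j$ meeting $\delta$ in that arc type. The $x_i$ are the quadrilateral coordinates; $y_p(s)$ denotes the coordinate of $s$ at the triangle type $p$. For each tetrahedron $\sigma^3$, $W_{\sigma^3}$ is the sum of its four triangle types minus the sum of its three quadrilateral types. For each edge $e$ of degree $k$ (formed by gluing $k$ edges $\tilde e_1,\dots,\tilde e_k$ of the unglued tetrahedra), $W_e=\sum_{i=1}^k(p_{s_i}+p_{r_i}-q_{l_i})$, where in the tetrahedron containing $\tilde e_i$, $q_{l_i}$ is the quadrilateral type disjoint from $\tilde e_i$ and $p_{s_i},p_{r_i}$ are the two triangle types meeting $\tilde e_i$. By a theorem of Kang and Rubinstein, $W_{\sigma^3_1},\dots,W_{\sigma^3_t},W_{e_1},\dots,W_{e_n}$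 is a basis of $C(K;\mathcal{T})$. **Generalised Euler characteristic.** $\chi^*:\mathbb{R}^{7t}\to\mathbb{R}$ is the linear function $\chi^*(x,y)=\sum_i x_i\chi^*(q_i)+\sum_j y_j\chi^*(p_j)$, where, with $d(e)$ the degree of $e$ and $b(D)$ the number of normal arcs in $D\cap\partial K$, $\chi^*(p)=-\tfrac12(1+b(p))+\sum_{a=0}^2\tfrac1{d(e_a)}$ for a triangle type meeting edges $e_0,e_1,e_2$ (with multiplicity) and $\chi^*(q)=-\tfrac12(2+b(q))+\sum_{a=0}^3\tfrac1{d(e_a)}$ for a quadrilateral type meeting edges $e_0,\dots,e_3$ (with multiplicity). **Angle structures with area-curvature $(A,\kappa)$.** A quadrilateral disc separates the interior of a 3-simplex into two wedges; up to normal isotopy there are six wedges in each 3-simplex, one for each edge of it. A generalised angle structure on $(K;\mathcal{T})$ is a real-valued function on the set of all wedges (of all tetrahedra). The combinatorial area of a triangle type is the sum of the angles of the three wedges at the three edges it meets, minus $\pi$. The curvature at an edge $e$ is $2\pi$ (if the interior of $e$ lies in the interior of $K$) or $\pi$ (if $e\subset\partial K$) minus the sum of the angles of all wedges containing $e$. Prescribed area-curvature functions $(A,\kappa)$ are functions $A:N_\Delta\to\mathbb{R}$ and $\kappa:\{\text{edges}\}\to\mathbb{R}$; $A\le0$ means $A(p)\le 0$ for all $p\in N_\Delta$. A generalised angle structure has area-curvature $(A,\kappa)$ if its areas of normal triangle types and curvatures at edges are given by $A$ and $\kappa$; it is a semi-angle structure (respectively angle structure) with area-curvature $(A,\kappa)$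 if in addition all its angles are non-negative (respectively positive). **The function $\chi^{(A,\kappa)}$.** It is the linear function on $C(K;\mathcal{T})$ given, for $s=\sum_{i=1}^t w_iW_{\sigma^3_i}+\sum_{j=1}^n z_jW_{e_j}$, by $\chi^{(A,\kappa)}(s)=\frac1{2\pi}\Big(\sum_{p\in N_\Delta}y_p(s)A(p)+\sum_{j=1}^n 2z_j\kappa(e_j)\Big)$. *)

theory Defs
  imports "HOL-Analysis.Analysis"
begin

section \<open>Triangulated 3-dimensional pseudo-manifolds\<close>

definition affine_iso :: "('a::euclidean_space \<Rightarrow> 'a) \<Rightarrow> 'a set \<Rightarrow> 'a set \<Rightarrow> bool" where
  "affine_iso \<phi> \<tau> \<delta> \<longleftrightarrow>
     bij_betw \<phi> \<tau> \<delta> \<and> (\<exists>f c. linear f \<and> (\<forall>x\<in>\<tau>. \<phi> x = f x + c))"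

text \<open>
  The disjoint union of 3-simplices is a finite family \<open>S\<close> of pairwise disjoint geometric
  3-simplices in some Euclidean space; the set \<open>\<Phi>\<close> consists of triples of a
  face, another face, and an affine isomorphism between them. Two faces of the same simplex may be
  paired, and an edge may be identified with itself in reverse.
\<close>

type_synonym 'a pairings = "('a set \<times> 'a set \<times> ('a \<Rightarrow> 'a)) set"

definition all_faces :: "'a::euclidean_space set set \<Rightarrow> 'a set set" where
  "all_faces S = {\<tau>. \<exists>\<sigma>\<in>S. \<tau> facet_of \<sigma>}"

definition all_edges :: "'a::euclidean_space set set \<Rightarrow> 'a set set" where
  "all_edges S = {e. \<exists>\<sigma>\<in>S. e edge_of \<sigma>}"

definition pseudo_manifold :: "'a::euclidean_space set set \<Rightarrow> 'a pairings \<Rightarrow> bool" where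
  "pseudo_manifold S \<Phi> \<longleftrightarrow>
     finite S \<and> (\<forall>\<sigma>\<in>S. 3 simplex \<sigma>) \<and> pairwise disjnt S \<and>
     (\<forall>(\<tau>, \<delta>, \<phi>)\<in>\<Phi>. \<tau> \<in> all_faces S \<and> \<delta> \<in> all_faces S \<and> \<tau> \<noteq> \<delta> \<and> affine_iso \<phi> \<tau> \<delta>) \<and>
     pairwise (\<lambda>(\<tau>, \<delta>, \<phi>) (\<tau>', \<delta>', \<phi>'). {\<tau>, \<delta>} \<inter> {\<tau>', \<delta>'} = {}) \<Phi>"

text \<open>
  The quotient map sends a point to its class under the equivalence relation generated by
  \<open>x \<sim> \<phi> x\<close>. The cells of \<open>K\<close> are images of (faces of) simplices under it, so an edge of \<open>K\<close> is a set
  of equivalence classes.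
\<close>

definition quotient_map_of :: "'a pairings \<Rightarrow> 'a \<Rightarrow> 'a set" where
  "quotient_map_of \<Phi> x =
     {y. equivclp (\<lambda>u v. \<exists>(\<tau>, \<delta>, \<phi>)\<in>\<Phi>. u \<in> \<tau> \<and> v = \<phi> u) x y}"

definition cell_image :: "'a pairings \<Rightarrow> 'a set \<Rightarrow> 'a set set" where
  "cell_image \<Phi> c = quotient_map_of \<Phi> ` c"

definition K_edges :: "'a::euclidean_space set set \<Rightarrow> 'a pairings \<Rightarrow> 'a set set set" where
  "K_edges S \<Phi> = cell_image \<Phi> ` all_edges S"

definition edges_over :: "'a::euclidean_space set set \<Rightarrow> 'a pairings \<Rightarrow> 'a set set \<Rightarrow> 'a set set" where
  "edges_over S \<Phi> e = {e' \<in> all_edges S. cell_image \<Phi> e' = e}"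

definition edge_degree :: "'a::euclidean_space set set \<Rightarrow> 'a pairings \<Rightarrow> 'a set set \<Rightarrow> nat" where
  "edge_degree S \<Phi> e = card (edges_over S \<Phi> e)"

definition unpaired_faces :: "'a::euclidean_space set set \<Rightarrow> 'a pairings \<Rightarrow> 'a set set" where
  "unpaired_faces S \<Phi> = {\<tau> \<in> all_faces S. \<forall>(\<tau>', \<delta>', \<phi>')\<in>\<Phi>. \<tau> \<notin> {\<tau>', \<delta>'}}"

definition K_boundary :: "'a::euclidean_space set set \<Rightarrow> 'a pairings \<Rightarrow> 'a set set" where
  "K_boundary S \<Phi> = (\<Union>\<tau>\<in>unpaired_faces S \<Phi>. cell_image \<Phi> \<tau>)"

section \<open>Normal disc types\<close>

text \<open>
  A normal isotopy class of discs in a simplex \<open>\<sigma>\<close> is given by what it separates: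
  \<open>Triangle \<sigma> v\<close> cuts off the vertex \<open>v\<close>, and \<open>Quad \<sigma> {e, e'}\<close> separates the opposite edges
  \<open>e\<close> and \<open>e'\<close>. Two edges of a tetrahedron are opposite iff they are disjoint.
\<close>

datatype 'a disc = Triangle "'a set" 'a | Quad "'a set" "'a set set"

definition triangles_in :: "'a::euclidean_space set \<Rightarrow> 'a disc set" where
  "triangles_in \<sigma> = {Triangle \<sigma> v | v. v extreme_point_of \<sigma>}"

definition quads_in :: "'a::euclidean_space set \<Rightarrow> 'a disc set" where
  "quads_in \<sigma> = {Quad \<sigma> {e, e'} | e e'. e edge_of \<sigma> \<and> e' edge_of \<sigma> \<and> e \<inter> e' = {}}"

definition triangle_types :: "'a::euclidean_space set set \<Rightarrow> 'a disc set" where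
  "triangle_types S = (\<Union>\<sigma>\<in>S. triangles_in \<sigma>)"

definition quad_types :: "'a::euclidean_space set set \<Rightarrow> 'a disc set" where
  "quad_types S = (\<Union>\<sigma>\<in>S. quads_in \<sigma>)"

fun disc_edges :: "'a::euclidean_space disc \<Rightarrow> 'a set set" where
  "disc_edges (Triangle \<sigma> v) = {e. e edge_of \<sigma> \<and> v \<in> e}"
| "disc_edges (Quad \<sigma> Q) = {e. e edge_of \<sigma> \<and> e \<notin> Q}"

text \<open>
  A normal arc type in a triangle is determined by the pair of edges that it joins; the arc in which
  a disc meets a face (if any) joins those edges of the face that the disc meets.
\<close>

definition arc_types :: "'a::euclidean_space set \<Rightarrow> 'a set set set" where
  "arc_types \<tau> = {a. a \<subseteq> {e. e edge_of \<tau>} \<and> card a = 2}"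

definition meets_in_arc :: "'a::euclidean_space disc \<Rightarrow> 'a set \<Rightarrow> 'a set set \<Rightarrow> bool" where
  "meets_in_arc D \<tau> a \<longleftrightarrow> a \<in> arc_types \<tau> \<and> disc_edges D \<inter> {e. e edge_of \<tau>} = a"

section \<open>The solution space\<close>

text \<open>
  Vectors in \<open>\<real>\<^sup>7\<^sup>t\<close> are functions on disc types that vanish off the actual disc types of \<open>S\<close>.
\<close>

definition solution_space ::
    "'a::euclidean_space set set \<Rightarrow> 'a pairings \<Rightarrow> ('a disc \<Rightarrow> real) set" where
  "solution_space S \<Phi> =
     {s. (\<forall>D. D \<notin> quad_types S \<union> triangle_types S \<longrightarrow> s D = 0) \<and>
         (\<forall>(\<tau>, \<delta>, \<phi>)\<in>\<Phi>. \<forall>\<sigma>\<in>S. \<forall>\<sigma>'\<in>S. \<tau> facet_of \<sigma> \<longrightarrow> \<delta> facet_of \<sigma>' \<longrightarrow>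
            (\<forall>a\<in>arc_types \<tau>.
              \<forall>q\<in>quads_in \<sigma>. \<forall>p\<in>triangles_in \<sigma>. \<forall>q'\<in>quads_in \<sigma>'. \<forall>p'\<in>triangles_in \<sigma>'.
                meets_in_arc q \<tau> a \<longrightarrow> meets_in_arc p \<tau> a \<longrightarrow>
                meets_in_arc q' \<delta> ((`) \<phi> ` a) \<longrightarrow> meets_in_arc p' \<delta> ((`) \<phi> ` a) \<longrightarrow>
                s q + s p = s q' + s p'))}"

definition basis_vec :: "'a disc \<Rightarrow> 'a disc \<Rightarrow> real" where
  "basis_vec D = (\<lambda>D'. if D' = D then 1 else 0)"

definition W_tet :: "'a::euclidean_space set \<Rightarrow> 'a disc \<Rightarrow> real" where
  "W_tet \<sigma> D = (\<Sum>p\<in>triangles_in \<sigma>. basis_vec p D) - (\<Sum>q\<in>quads_in \<sigma>. basis_vec q D)"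

text \<open>
  For an edge \<open>e'\<close> of a tetrahedron the first inner sum has two terms (the triangle types at the ends
  of \<open>e'\<close>) and the second has one (the quadrilateral type facing \<open>e'\<close>).
\<close>

definition W_edge ::
    "'a::euclidean_space set set \<Rightarrow> 'a pairings \<Rightarrow> 'a set set \<Rightarrow> 'a disc \<Rightarrow> real" where
  "W_edge S \<Phi> e D =
     (\<Sum>e'\<in>edges_over S \<Phi> e.
        (\<Sum>p\<in>{p \<in> triangle_types S. e' \<in> disc_edges p}. basis_vec p D) -
        (\<Sum>q\<in>{q. \<exists>\<sigma>\<in>S. e' edge_of \<sigma> \<and> q \<in> quads_in \<sigma> \<and> e' \<notin> disc_edges q}. basis_vec q D))"

definition W_comb ::
    "'a::euclidean_space set set \<Rightarrow> 'a pairings \<Rightarrow> ('a set \<Rightarrow> real) \<Rightarrow> ('a set set \<Rightarrow> real)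
      \<Rightarrow> 'a disc \<Rightarrow> real" where
  "W_comb S \<Phi> w z = (\<lambda>D. (\<Sum>\<sigma>\<in>S. w \<sigma> * W_tet \<sigma> D) + (\<Sum>e\<in>K_edges S \<Phi>. z e * W_edge S \<Phi> e D))"

section \<open>Generalised Euler characteristic\<close>

fun disc_tet :: "'a disc \<Rightarrow> 'a set" where
  "disc_tet (Triangle \<sigma> v) = \<sigma>"
| "disc_tet (Quad \<sigma> Q) = \<sigma>"

definition boundary_arcs :: "'a::euclidean_space set set \<Rightarrow> 'a pairings \<Rightarrow> 'a disc \<Rightarrow> nat" where
  "boundary_arcs S \<Phi> D =
     card {\<tau>. \<tau> facet_of disc_tet D \<and> \<tau> \<in> unpaired_faces S \<Phi> \<and> (\<exists>a. meets_in_arc D \<tau> a)}"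

fun chi_star_disc :: "'a::euclidean_space set set \<Rightarrow> 'a pairings \<Rightarrow> 'a disc \<Rightarrow> real" where
  "chi_star_disc S \<Phi> (Triangle \<sigma> v) =
     - (1/2) * (1 + real (boundary_arcs S \<Phi> (Triangle \<sigma> v))) +
     (\<Sum>e\<in>disc_edges (Triangle \<sigma> v). 1 / real (edge_degree S \<Phi> (cell_image \<Phi> e)))"
| "chi_star_disc S \<Phi> (Quad \<sigma> Q) =
     - (1/2) * (2 + real (boundary_arcs S \<Phi> (Quad \<sigma> Q))) +
     (\<Sum>e\<in>disc_edges (Quad \<sigma> Q). 1 / real (edge_degree S \<Phi> (cell_image \<Phi> e)))"

definition chi_star :: "'a::euclidean_space set set \<Rightarrow> 'a pairings \<Rightarrow> ('a disc \<Rightarrow> real) \<Rightarrow> real" where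
  "chi_star S \<Phi> s =
     (\<Sum>q\<in>quad_types S. s q * chi_star_disc S \<Phi> q) +
     (\<Sum>p\<in>triangle_types S. s p * chi_star_disc S \<Phi> p)"

section \<open>Angle structures with prescribed area-curvature\<close>

text \<open>
  The wedges correspond to the edges of the unglued simplices, so a generalised angle
  structure is a real function on \<open>all_edges S\<close> (its values elsewhere are never used).
\<close>

definition area :: "('a::euclidean_space set \<Rightarrow> real) \<Rightarrow> 'a disc \<Rightarrow> real" where
  "area \<alpha> p = (\<Sum>e\<in>disc_edges p. \<alpha> e) - pi"

definition curvature ::
    "'a::euclidean_space set set \<Rightarrow> 'a pairings \<Rightarrow> ('a set \<Rightarrow> real) \<Rightarrow> 'a set set \<Rightarrow> real" where
  "curvature S \<Phi> \<alpha> e =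
     (if e \<subseteq> K_boundary S \<Phi> then pi else 2 * pi) - (\<Sum>e'\<in>edges_over S \<Phi> e. \<alpha> e')"

definition has_area_curvature ::
    "'a::euclidean_space set set \<Rightarrow> 'a pairings \<Rightarrow> ('a disc \<Rightarrow> real) \<Rightarrow> ('a set set \<Rightarrow> real)
      \<Rightarrow> ('a set \<Rightarrow> real) \<Rightarrow> bool" where
  "has_area_curvature S \<Phi> A \<kappa> \<alpha> \<longleftrightarrow>
     (\<forall>p\<in>triangle_types S. area \<alpha> p = A p) \<and> (\<forall>e\<in>K_edges S \<Phi>. curvature S \<Phi> \<alpha> e = \<kappa> e)"

definition semi_angle_structure ::
    "'a::euclidean_space set set \<Rightarrow> 'a pairings \<Rightarrow> ('a disc \<Rightarrow> real) \<Rightarrow> ('a set set \<Rightarrow> real)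
      \<Rightarrow> ('a set \<Rightarrow> real) \<Rightarrow> bool" where
  "semi_angle_structure S \<Phi> A \<kappa> \<alpha> \<longleftrightarrow>
     has_area_curvature S \<Phi> A \<kappa> \<alpha> \<and> (\<forall>e\<in>all_edges S. \<alpha> e \<ge> 0)"

definition angle_structure ::
    "'a::euclidean_space set set \<Rightarrow> 'a pairings \<Rightarrow> ('a disc \<Rightarrow> real) \<Rightarrow> ('a set set \<Rightarrow> real)
      \<Rightarrow> ('a set \<Rightarrow> real) \<Rightarrow> bool" where
  "angle_structure S \<Phi> A \<kappa> \<alpha> \<longleftrightarrow>
     has_area_curvature S \<Phi> A \<kappa> \<alpha> \<and> (\<forall>e\<in>all_edges S. \<alpha> e > 0)"

text \<open>
  The value at \<open>s\<close> is read off from the coordinates of \<open>s\<close> in the Kang-Rubinstein basis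
  of the solution space. Only values at elements of \<open>solution_space S \<Phi>\<close> are meaningful; there the
  description is satisfied by exactly one number, because the \<open>W_tet \<sigma>\<close> and \<open>W_edge S \<Phi> e\<close> form
  a basis.
\<close>

definition chi_area_curvature ::
    "'a::euclidean_space set set \<Rightarrow> 'a pairings \<Rightarrow> ('a disc \<Rightarrow> real) \<Rightarrow> ('a set set \<Rightarrow> real)
      \<Rightarrow> ('a disc \<Rightarrow> real) \<Rightarrow> real" where
  "chi_area_curvature S \<Phi> A \<kappa> s =
     (THE r. \<exists>w z. s = W_comb S \<Phi> w z \<and>
        r = 1 / (2 * pi) *
            ((\<Sum>p\<in>triangle_types S. s p * A p) + (\<Sum>e\<in>K_edges S \<Phi>. 2 * z e * \<kappa> e)))"

end

theory Submission
  imports Defs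
begin

text \<open>
  To every edge of a tetrahedron before gluing, a vector \<open>s\<close> on the disc types assigns a weight: the sum
  of the coordinates of the types that meet the edge, that is, the number of points in which a normal
  surface with these coordinates meets it. The proof reads everything off these weights.

  A disc that meets an edge of a face meets the face in a normal arc ending on that edge. So the
  weight of an edge of the face is the sum of two arc counts, and the matching equations make
  weights agree on edges that are glued together (\<open>edge_weight_glued_face\<close>). The vector of a
  tetrahedron has weight 0 at every edge; the vector of an edge \<open>e\<close> of the quotient has weight 2 at the edges over
  \<open>e\<close> and 0 at all others. Hence the coefficient \<open>z e\<close> in any expansion of \<open>s\<close> is half the weight of \<open>s\<close>
  over \<open>e\<close> (\<open>edge_weight_W_comb\<close>), which is why \<open>chi_area_curvature\<close> is well defined. Conversely,
  within one tetrahedron the six weights determine the seven coordinates up to a multiple of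
  the tetrahedron vector, so every solution has such an expansion (\<open>solution_space_W_comb\<close>).

  Now sum the angles \<open>\<alpha>\<close> over all corners of discs in \<open>s\<close>, disc by disc and edge by edge. On one side
  triangles contribute their areas, on the other side edges contribute their curvatures. The
  outcome is the Gauss-Bonnet formula (\<open>Gauss_Bonnet\<close>)
  \<open>2\<pi>(\<chi>\<^sup>*(s) - \<chi>(s)) = \<Sum>q. s q (\<alpha>(q) - 2\<pi>)\<close>, where \<open>\<chi>\<close> is the function \<open>chi_area_curvature\<close>, the sum
  runs over the quadrilateral types and \<open>\<alpha>(q)\<close> is the sum of the four angles at the corners of \<open>q\<close>. The
  boundary terms of both sides agree because every boundary edge of the quotient lies in exactly two
  unpaired faces, counted before gluing (\<open>card_boundary_flags\<close>): the tetrahedra around an edge form a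
  path or a cycle.

  Finally, the areas of the four triangles of a tetrahedron count each of its six angles twice, so
  \<open>A \<le> 0\<close> bounds the sum of the six angles by \<open>2\<pi>\<close>. It exceeds \<open>\<alpha>(q)\<close> by the two angles at the edges
  that \<open>q\<close> faces (\<open>sum_angles_quad\<close>), whence \<open>\<alpha>(q) \<le> 2\<pi>\<close> for a semi-angle structure and
  \<open>\<alpha>(q) < 2\<pi>\<close> for an angle structure.
\<close>

section \<open>Tetrahedra\<close>

text \<open>
  A vertex outside \<open>Y\<close> together with \<open>Y\<close> is affinely independent, so its hull misses the hull of \<open>Y\<close>.
\<close>

lemma convex_hull_subset_iff_affine_independent:
  fixes C :: "'a::euclidean_space set"
  assumes "\<not> affine_dependent C" "X \<subseteq> C" "Y \<subseteq> C"
  shows "convex hull X \<subseteq> convex hull Y \<longleftrightarrow> X \<subseteq> Y"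
proof
  assume sub: "convex hull X \<subseteq> convex hull Y"
  show "X \<subseteq> Y"
  proof
    fix x assume x: "x \<in> X"
    have "\<not> affine_dependent ({x} \<union> Y)"
      using assms x by (intro affine_independent_subset[OF assms(1)]) auto
    then have "convex hull ({x} \<inter> Y) = convex hull {x} \<inter> convex hull Y"
      by (rule convex_hull_Int)
    moreover have "x \<in> convex hull Y"
      using x sub hull_subset[of X convex] by blast
    ultimately show "x \<in> Y"
      by (cases "x \<in> Y") auto
  qed
qed (rule hull_mono)

lemma convex_hull_eq_iff_affine_independent:
  fixes C :: "'a::euclidean_space set"
  assumes "\<not> affine_dependent C" "X \<subseteq> C" "Y \<subseteq> C"
  shows "convex hull X = convex hull Y \<longleftrightarrow> X = Y"
  using convex_hull_subset_iff_affine_independent[OF assms]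
    convex_hull_subset_iff_affine_independent[OF assms(1,3,2)] by blast

lemma aff_dim_convex_hull_subset:
  fixes C :: "'a::euclidean_space set"
  assumes "\<not> affine_dependent C" "X \<subseteq> C"
  shows "aff_dim (convex hull X) = int (card X) - 1"
  using aff_dim_affine_independent[OF affine_independent_subset[OF assms]]
  by (simp add: aff_dim_convex_hull)

lemma edge_of_convex_hull_affine_independent:
  fixes C :: "'a::euclidean_space set"
  assumes "\<not> affine_dependent C"
  shows "e edge_of convex hull C \<longleftrightarrow> (\<exists>X\<subseteq>C. card X = 2 \<and> e = convex hull X)"
proof -
  have "aff_dim (convex hull X) = 1 \<longleftrightarrow> card X = 2" if "X \<subseteq> C" for X
    using aff_dim_convex_hull_subset[OF assms that] by linarith
  then show ?thesis
    unfolding edge_of_def face_of_convex_hull_affine_independent[OF assms] by blast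
qed

lemma facet_of_convex_hull_affine_independent:
  fixes C :: "'a::euclidean_space set"
  assumes "\<not> affine_dependent C" "card C > 1"
  shows "\<tau> facet_of convex hull C \<longleftrightarrow> (\<exists>X\<subseteq>C. Suc (card X) = card C \<and> \<tau> = convex hull X)"
proof -
  have "convex hull X \<noteq> {} \<and> aff_dim (convex hull X) = aff_dim (convex hull C) - 1 \<longleftrightarrow>
      Suc (card X) = card C" if "X \<subseteq> C" for X
  proof -
    have "X = {} \<Longrightarrow> Suc (card X) \<noteq> card C" using assms(2) by auto
    moreover have "aff_dim (convex hull X) = aff_dim (convex hull C) - 1 \<longleftrightarrow> Suc (card X) = card C"
      using aff_dim_convex_hull_subset[OF assms(1) that]
        aff_dim_convex_hull_subset[OF assms(1) order_refl] by linarith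
    ultimately show ?thesis unfolding convex_hull_eq_empty by blast
  qed
  then show ?thesis
    unfolding facet_of_def face_of_convex_hull_affine_independent[OF assms(1)] by blast
qed

lemma two_subsets_of_four:
  assumes "distinct [a,b,c,d]"
  shows "{X. X \<subseteq> {a,b,c,d} \<and> card X = 2} = {{a,b},{a,c},{a,d},{b,c},{b,d},{c,d}}"
    (is "?L = ?R")
proof
  show "?L \<subseteq> ?R"
  proof
    fix X assume "X \<in> ?L"
    then obtain x y where X: "X = {x,y}" "x \<noteq> y" "x \<in> {a,b,c,d}" "y \<in> {a,b,c,d}"
      by (auto simp: card_2_iff)
    then show "X \<in> ?R"
      by (elim insertE emptyE) (simp_all add: insert_commute)
  qed
qed (use assms in simp)

lemma two_subsets_of_three:
  assumes "distinct [a,b,c]"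
  shows "{X. X \<subseteq> {a,b,c} \<and> card X = 2} = {{a,b},{a,c},{b,c}}" (is "?L = ?R")
proof
  show "?L \<subseteq> ?R"
  proof
    fix X assume "X \<in> ?L"
    then obtain x y where X: "X = {x,y}" "x \<noteq> y" "x \<in> {a,b,c}" "y \<in> {a,b,c}"
      by (auto simp: card_2_iff)
    then show "X \<in> ?R"
      by (elim insertE emptyE) (simp_all add: insert_commute)
  qed
qed (use assms in simp)

lemma three_subsets_of_four:
  assumes "distinct [a,b,c,d]"
  shows "{X. X \<subseteq> {a,b,c,d} \<and> card X = 3} = {{a,b,c},{a,b,d},{a,c,d},{b,c,d}}"
    (is "?L = ?R")
proof
  show "?L \<subseteq> ?R"
  proof
    fix X assume "X \<in> ?L"
    then have X: "X \<subseteq> {a,b,c,d}" "card X = 3" by simp_all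
    have card4: "card {a,b,c,d} = 4" using assms by simp
    have "X \<noteq> {a,b,c,d}"
    proof
      assume "X = {a,b,c,d}"
      with card4 X(2) show False by simp
    qed
    then obtain w where w: "w \<in> {a,b,c,d}" "w \<notin> X" using X(1) by blast
    have "card ({a,b,c,d} - {w}) = 3"
      using card4 w(1) by (simp only: card_Diff_singleton)
    moreover have "X \<subseteq> {a,b,c,d} - {w}"
      using X(1) w(2) by (simp add: subset_Diff_insert)
    ultimately have X': "X = {a,b,c,d} - {w}"
      using X(2) by (intro card_subset_eq) simp_all
    have "{a,b,c,d} - {a} = {b,c,d}" "{a,b,c,d} - {b} = {a,c,d}"
      "{a,b,c,d} - {c} = {a,b,d}" "{a,b,c,d} - {d} = {a,b,c}"
      using assms by auto
    then show "X \<in> ?R" using w(1) unfolding X' by (elim insertE emptyE) simp_all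
  qed
qed (use assms in simp)

locale tetrahedron =
  fixes a b c d :: "'a::euclidean_space" and \<sigma> :: "'a set"
  assumes independent: "\<not> affine_dependent {a,b,c,d}"
    and distinct: "distinct [a,b,c,d]"
    and hull: "\<sigma> = convex hull {a,b,c,d}"
begin

abbreviation edge :: "'a \<Rightarrow> 'a \<Rightarrow> 'a set" where "edge x y \<equiv> convex hull {x,y}"

lemma vertices_neq [simp]:
  "a \<noteq> b" "a \<noteq> c" "a \<noteq> d" "b \<noteq> c" "b \<noteq> d" "c \<noteq> d"
  "b \<noteq> a" "c \<noteq> a" "d \<noteq> a" "c \<noteq> b" "d \<noteq> b" "d \<noteq> c"
  using distinct by auto

lemma hull_eq_iff [simp]:
  assumes "X \<subseteq> {a,b,c,d}" "Y \<subseteq> {a,b,c,d}"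
  shows "convex hull X = convex hull Y \<longleftrightarrow> X = Y"
  using convex_hull_eq_iff_affine_independent[OF independent assms] .

lemma vertex_in_hull_iff [simp]:
  assumes "x \<in> {a,b,c,d}" "Y \<subseteq> {a,b,c,d}"
  shows "x \<in> convex hull Y \<longleftrightarrow> x \<in> Y"
  using convex_hull_subset_iff_affine_independent[OF independent _ assms(2), of "{x}"] assms(1)
  by simp

lemma hull_disjoint_iff:
  assumes "X \<subseteq> {a,b,c,d}" "Y \<subseteq> {a,b,c,d}"
  shows "convex hull X \<inter> convex hull Y = {} \<longleftrightarrow> X \<inter> Y = {}"
proof -
  have "\<not> affine_dependent (X \<union> Y)"
    using assms independent affine_independent_subset by (metis Un_least)
  from convex_hull_Int[OF this] show ?thesis by (metis convex_hull_eq_empty)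
qed

lemma edge_of_iff: "e edge_of \<sigma> \<longleftrightarrow>
    e \<in> {edge a b, edge a c, edge a d, edge b c, edge b d, edge c d}"
proof -
  have "e edge_of \<sigma> \<longleftrightarrow> (\<exists>X\<in>{X. X \<subseteq> {a,b,c,d} \<and> card X = 2}. e = convex hull X)"
    unfolding hull edge_of_convex_hull_affine_independent[OF independent] by auto
  then show ?thesis
    unfolding two_subsets_of_four[OF distinct] by auto
qed

lemma edges: "{e. e edge_of \<sigma>} = {edge a b, edge a c, edge a d, edge b c, edge b d, edge c d}"
  using edge_of_iff by auto

lemma facets: "{\<tau>. \<tau> facet_of \<sigma>} =
    {convex hull {a,b,c}, convex hull {a,b,d}, convex hull {a,c,d}, convex hull {b,c,d}}"
proof -
  have "\<tau> facet_of \<sigma> \<longleftrightarrow> (\<exists>X\<in>{X. X \<subseteq> {a,b,c,d} \<and> card X = 3}. \<tau> = convex hull X)" for \<tau>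
    unfolding hull by (subst facet_of_convex_hull_affine_independent[OF independent]) auto
  then show ?thesis
    unfolding three_subsets_of_four[OF distinct] by auto
qed

lemma edges_abc: "{e. e edge_of convex hull {a,b,c}} = {edge a b, edge a c, edge b c}"
proof -
  have "\<not> affine_dependent {a,b,c}"
    using independent by (rule affine_independent_subset) auto
  then have "{e. e edge_of convex hull {a,b,c}} =
      {convex hull X |X. X \<in> {X. X \<subseteq> {a,b,c} \<and> card X = 2}}"
    by (auto simp: edge_of_convex_hull_affine_independent)
  moreover have "distinct [a,b,c]" by simp
  ultimately show ?thesis
    by (simp only: two_subsets_of_three) auto
qed

lemma triangles: "triangles_in \<sigma> = {Triangle \<sigma> a, Triangle \<sigma> b, Triangle \<sigma> c, Triangle \<sigma> d}"
  unfolding triangles_in_def hull extreme_point_of_convex_hull_affine_independent[OF independent]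
  by auto

lemma quads: "quads_in \<sigma> =
    {Quad \<sigma> {edge a b, edge c d}, Quad \<sigma> {edge a c, edge b d}, Quad \<sigma> {edge a d, edge b c}}"
  (is "_ = ?R")
proof
  show "quads_in \<sigma> \<subseteq> ?R"
  proof
    fix D assume "D \<in> quads_in \<sigma>"
    then obtain e e' where D: "D = Quad \<sigma> {e, e'}" and "e edge_of \<sigma>" "e' edge_of \<sigma>"
      and "e \<inter> e' = {}"
      unfolding quads_in_def by blast
    then show "D \<in> ?R"
      unfolding edge_of_iff D
      by (elim insertE emptyE) (simp_all add: hull_disjoint_iff doubleton_eq_iff)
  qed
  have "edge a b \<inter> edge c d = {}" "edge a c \<inter> edge b d = {}" "edge a d \<inter> edge b c = {}"
    by (simp_all add: hull_disjoint_iff)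
  moreover have "edge a b edge_of \<sigma>" "edge a c edge_of \<sigma>" "edge a d edge_of \<sigma>"
    "edge b c edge_of \<sigma>" "edge b d edge_of \<sigma>" "edge c d edge_of \<sigma>"
    unfolding edge_of_iff by blast+
  ultimately show "?R \<subseteq> quads_in \<sigma>"
    unfolding quads_in_def by blast
qed

lemma disc_edges_Triangle:
  "disc_edges (Triangle \<sigma> a) = {edge a b, edge a c, edge a d}"
  "disc_edges (Triangle \<sigma> b) = {edge a b, edge b c, edge b d}"
  "disc_edges (Triangle \<sigma> c) = {edge a c, edge b c, edge c d}"
  "disc_edges (Triangle \<sigma> d) = {edge a d, edge b d, edge c d}"
  unfolding disc_edges.simps edge_of_iff by auto

lemma disc_edges_Quad:
  "disc_edges (Quad \<sigma> {edge a b, edge c d}) = {edge a c, edge a d, edge b c, edge b d}"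
  "disc_edges (Quad \<sigma> {edge a c, edge b d}) = {edge a b, edge a d, edge b c, edge c d}"
  "disc_edges (Quad \<sigma> {edge a d, edge b c}) = {edge a b, edge a c, edge b d, edge c d}"
  unfolding disc_edges.simps edge_of_iff by (auto simp: doubleton_eq_iff)

lemmas disc_edges_simps = disc_edges_Triangle disc_edges_Quad

end

lemma tetrahedron_exists:
  assumes "3 simplex \<sigma>" shows "\<exists>a b c d. tetrahedron a b c d \<sigma>"
proof -
  obtain C where C: "\<not> affine_dependent C" "int (card C) = 4" "\<sigma> = convex hull C"
    using assms unfolding simplex_def by auto
  then have "card C = 4" by linarith
  then obtain a b c d where "C = {a,b,c,d}" "distinct [a,b,c,d]"
    by (auto simp: eval_nat_numeral card_Suc_eq)
  then show ?thesis
    using C unfolding tetrahedron_def by blast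
qed

text \<open>
  The roles of the four vertices are interchangeable. Relabelling lets an arbitrary facet be \<open>abc\<close> and
  an arbitrary edge be \<open>ab\<close>, which keeps the case distinctions on disc types short.
\<close>

lemma tetrahedron_relabel:
  assumes "tetrahedron a b c d \<sigma>" "distinct [x,y,z,w]" "{x,y,z,w} = {a,b,c,d}"
  shows "tetrahedron x y z w \<sigma>"
  using assms unfolding tetrahedron_def by simp

lemma tetrahedron_relabelings:
  assumes "tetrahedron a b c d \<sigma>"
  shows "tetrahedron b a c d \<sigma>" "tetrahedron c a b d \<sigma>" "tetrahedron d a b c \<sigma>"
    "tetrahedron a c b d \<sigma>" "tetrahedron a d b c \<sigma>" "tetrahedron b c a d \<sigma>"
    "tetrahedron b d a c \<sigma>" "tetrahedron c d a b \<sigma>"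
proof -
  interpret tetrahedron a b c d \<sigma> by fact
  show "tetrahedron b a c d \<sigma>" "tetrahedron c a b d \<sigma>" "tetrahedron d a b c \<sigma>"
    "tetrahedron a c b d \<sigma>" "tetrahedron a d b c \<sigma>" "tetrahedron b c a d \<sigma>"
    "tetrahedron b d a c \<sigma>" "tetrahedron c d a b \<sigma>"
    by (rule tetrahedron_relabel[OF assms]; auto)+
qed

lemma tetrahedron_facet:
  assumes "3 simplex \<sigma>" "\<tau> facet_of \<sigma>"
  shows "\<exists>a b c d. tetrahedron a b c d \<sigma> \<and> \<tau> = convex hull {a,b,c}"
proof -
  obtain a b c d where t: "tetrahedron a b c d \<sigma>"
    using tetrahedron_exists[OF assms(1)] by blast
  interpret tetrahedron a b c d \<sigma> by fact
  have "tetrahedron a b d c \<sigma>" "tetrahedron a c d b \<sigma>" "tetrahedron b c d a \<sigma>"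
    by (rule tetrahedron_relabel[OF t]; auto)+
  moreover have "\<tau> \<in> {\<tau>. \<tau> facet_of \<sigma>}" using assms by simp
  ultimately show ?thesis
    using t unfolding facets by blast
qed

lemma tetrahedron_edge:
  assumes "3 simplex \<sigma>" "e edge_of \<sigma>"
  shows "\<exists>a b c d. tetrahedron a b c d \<sigma> \<and> e = convex hull {a,b}"
proof -
  obtain a b c d where t: "tetrahedron a b c d \<sigma>"
    using tetrahedron_exists[OF assms(1)] by blast
  interpret tetrahedron a b c d \<sigma> by fact
  have "tetrahedron a c b d \<sigma>" "tetrahedron a d b c \<sigma>" "tetrahedron b c a d \<sigma>"
    "tetrahedron b d a c \<sigma>" "tetrahedron c d a b \<sigma>"
    by (rule tetrahedron_relabel[OF t]; auto)+
  then show ?thesis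
    using t assms(2) unfolding edge_of_iff by blast
qed

definition discs_in :: "'a::euclidean_space set \<Rightarrow> 'a disc set" where
  "discs_in \<sigma> = quads_in \<sigma> \<union> triangles_in \<sigma>"

text \<open>
  A normal arc has two endpoints, on different edges of the face. This turns counts of arcs into counts
  of corners.
\<close>

lemma card_disc_edges_facet:
  assumes "3 simplex \<sigma>" "\<tau> facet_of \<sigma>" "D \<in> discs_in \<sigma>"
  shows "card (disc_edges D \<inter> {e. e edge_of \<tau>}) = (if \<exists>a. meets_in_arc D \<tau> a then 2 else 0)"
proof -
  obtain a b c d where t: "tetrahedron a b c d \<sigma>" and \<tau>: "\<tau> = convex hull {a,b,c}"
    using tetrahedron_facet[OF assms(1,2)] by blast
  interpret tetrahedron a b c d \<sigma> by fact
  have "card (disc_edges D \<inter> {e. e edge_of \<tau>}) \<in> {0,2}"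
    using assms(3) unfolding discs_in_def quads triangles \<tau> edges_abc
    by (auto simp only: disc_edges_simps Un_iff insert_iff empty_iff) (auto simp: doubleton_eq_iff Int_insert_left)
  moreover have "(\<exists>a. meets_in_arc D \<tau> a) \<longleftrightarrow> card (disc_edges D \<inter> {e. e edge_of \<tau>}) = 2"
    unfolding meets_in_arc_def arc_types_def by auto
  ultimately show ?thesis by auto
qed

lemma card_facets_containing_edge:
  assumes "3 simplex \<sigma>" "e edge_of \<sigma>"
  shows "card {\<tau>. \<tau> facet_of \<sigma> \<and> e \<subseteq> \<tau>} = 2"
proof -
  obtain a b c d where t: "tetrahedron a b c d \<sigma>" and e: "e = convex hull {a,b}"
    using tetrahedron_edge[OF assms] by blast
  interpret tetrahedron a b c d \<sigma> by fact
  have sub: "e \<subseteq> convex hull X \<longleftrightarrow> {a,b} \<subseteq> X" if "X \<subseteq> {a,b,c,d}" for X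
    unfolding e by (rule convex_hull_subset_iff_affine_independent[OF independent _ that]) auto
  have "{\<tau>. \<tau> facet_of \<sigma> \<and> e \<subseteq> \<tau>} = {\<tau> \<in> {\<tau>. \<tau> facet_of \<sigma>}. e \<subseteq> \<tau>}" by auto
  also have "\<dots> = {convex hull {a,b,c}, convex hull {a,b,d}}"
  proof -
    have "e \<subseteq> convex hull {a,b,c}" "e \<subseteq> convex hull {a,b,d}"
      "\<not> e \<subseteq> convex hull {a,c,d}" "\<not> e \<subseteq> convex hull {b,c,d}"
      by (simp_all add: sub del: hull_eq_iff)
    then show ?thesis unfolding facets by blast
  qed
  finally show ?thesis by (simp add: insert_eq_iff)
qed

lemma edge_of_facet:
  assumes "\<tau> facet_of \<sigma>" "e edge_of \<sigma>"
  shows "e edge_of \<tau> \<longleftrightarrow> e \<subseteq> \<tau>"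
  using assms unfolding facet_of_def edge_of_def
  by (meson face_of_face face_of_imp_subset)

section \<open>Connected multigraphs\<close>

text \<open>
  A spanning tree has one edge less than it has vertices. Such a tree is grown edge by edge: as long as some vertex
  is missing, connectedness yields an edge that leaves the current tree.
\<close>

lemma connected_multigraph_card_le:
  assumes "finite V" "finite M"
    and ends: "\<And>m. m \<in> M \<Longrightarrow> src m \<in> V \<and> tgt m \<in> V"
    and conn: "\<And>u v. u \<in> V \<Longrightarrow> v \<in> V \<Longrightarrow> equivclp (\<lambda>x y. \<exists>m\<in>M. src m = x \<and> tgt m = y) u v"
  shows "card V \<le> card M + 1"
proof -
  have tree: "\<exists>T N. T \<subseteq> V \<and> card T = Suc n \<and> N \<subseteq> M \<and> card N = n \<and> (\<forall>m\<in>N. src m \<in> T \<and> tgt m \<in> T)"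
    if "n < card V" for n
    using that
  proof (induction n)
    case 0
    then obtain v where "v \<in> V" by fastforce
    then show ?case by (intro exI[of _ "{v}"] exI[of _ "{}"]) auto
  next
    case (Suc n)
    then obtain T N where T: "T \<subseteq> V" "card T = Suc n" and N: "N \<subseteq> M" "card N = n"
      and in_T: "\<forall>m\<in>N. src m \<in> T \<and> tgt m \<in> T"
      by auto
    have fin: "finite T" "finite N"
      using T N assms(1,2) by (auto dest: finite_subset)
    obtain u where u: "u \<in> T" using T(2) by fastforce
    have "T \<noteq> V" using T(2) Suc.prems by auto
    then obtain v where v: "v \<in> V" "v \<notin> T" using T(1) by blast
    have "\<exists>m\<in>M. (src m \<in> T) \<noteq> (tgt m \<in> T)"
    proof (rule ccontr)
      assume none: "\<not> ?thesis"
      have "equivclp (\<lambda>x y. \<exists>m\<in>M. src m = x \<and> tgt m = y) u v"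
        using conn u v T(1) by blast
      then have "v \<in> T"
        by (induction rule: equivclp_induct) (use u none in auto)
      with v show False by simp
    qed
    then obtain m x where m: "m \<in> M" "m \<notin> N" and x: "x \<in> V" "x \<notin> T"
      and mT: "src m \<in> insert x T" "tgt m \<in> insert x T"
      using in_T ends by (metis insertCI)
    show ?case
      using T N m x mT fin in_T by (intro exI[of _ "insert x T"] exI[of _ "insert m N"]) auto
  qed
  show ?thesis
  proof (cases "card V")
    case (Suc n)
    then obtain N where "N \<subseteq> M" "card N = n" using tree[of n] by auto
    then show ?thesis using Suc card_mono[OF assms(2)] by fastforce
  qed simp
qed

text \<open>
  A connected multigraph in which every vertex carries two half-edges, some of them joined in pairs to form
  the edges \<open>M\<close>, is a path or a cycle, so it has two or no free half-edges. Numerically: the number of free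
  half-edges is twice the number of vertices minus twice the number of edges, hence even, and it is at most 2
  by the bound on the edges of a connected multigraph. The maps \<open>h\<close> and \<open>k\<close> send an edge to its two
  half-edges; loops and parallel edges occur, for instance if an edge is glued to itself.
\<close>

lemma card_free_half_edges:
  assumes "finite V" "finite H" "card H = 2 * card V"
    and ends: "\<And>m. m \<in> M \<Longrightarrow> src m \<in> V \<and> tgt m \<in> V"
    and conn: "\<And>u v. u \<in> V \<Longrightarrow> v \<in> V \<Longrightarrow> equivclp (\<lambda>x y. \<exists>m\<in>M. src m = x \<and> tgt m = y) u v"
    and half: "h ` M \<subseteq> H" "k ` M \<subseteq> H" "inj_on h M" "inj_on k M" "h ` M \<inter> k ` M = {}"
  shows "card (H - h ` M - k ` M) \<in> {0, 2}"
proof -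
  have fin: "finite (h ` M)" "finite (k ` M)"
    using half(1,2) assms(2) finite_subset by blast+
  have finM: "finite M" using fin(1) half(3) by (rule finite_imageD)
  have "card V \<le> card M + 1"
    by (rule connected_multigraph_card_le[OF assms(1) finM ends conn])
  moreover have "H - h ` M - k ` M = H - (h ` M \<union> k ` M)" by blast
  then have "card (H - h ` M - k ` M) = card H - card (h ` M \<union> k ` M)"
    using half(1,2) fin by (simp add: card_Diff_subset)
  moreover have "card (h ` M \<union> k ` M) = 2 * card M"
    using half fin by (simp add: card_Un_disjoint card_image)
  moreover have "card (h ` M \<union> k ` M) \<le> card H"
    using half(1,2) assms(2) by (intro card_mono) auto
  ultimately show ?thesis using assms(3) by auto
qed

section \<open>Edge classes in the quotient\<close>

lemma affine_iso_convex_hull: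
  assumes "affine_iso \<phi> \<tau> \<delta>" "convex hull X \<subseteq> \<tau>"
  shows "\<phi> ` (convex hull X) = convex hull (\<phi> ` X)"
proof -
  obtain f c where f: "linear f" and "\<forall>x\<in>\<tau>. \<phi> x = f x + c"
    using assms(1) unfolding affine_iso_def by blast
  then have eq: "\<And>x. x \<in> \<tau> \<Longrightarrow> \<phi> x = c + f x" by (simp add: add.commute)
  have "\<phi> ` (convex hull X) = (\<lambda>x. c + x) ` (f ` (convex hull X))"
    unfolding image_image using eq assms(2) by (intro image_cong) auto
  also have "\<dots> = convex hull ((\<lambda>x. c + x) ` (f ` X))"
    by (simp add: convex_hull_linear_image[OF f] convex_hull_translation)
  also have "(\<lambda>x. c + x) ` (f ` X) = \<phi> ` X"
    unfolding image_image using eq assms(2) hull_subset[of X convex] by (intro image_cong) auto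
  finally show ?thesis .
qed

lemma affine_iso_rel_interior:
  assumes "affine_iso \<phi> \<tau> \<delta>" "convex e" "e \<subseteq> \<tau>"
  shows "rel_interior (\<phi> ` e) = \<phi> ` rel_interior e"
proof -
  obtain f c where f: "linear f" and "\<forall>x\<in>\<tau>. \<phi> x = f x + c"
    using assms(1) unfolding affine_iso_def by blast
  then have eq: "\<And>x. x \<in> \<tau> \<Longrightarrow> \<phi> x = c + f x" by (simp add: add.commute)
  have image: "\<phi> ` X = (\<lambda>x. c + x) ` (f ` X)" if "X \<subseteq> \<tau>" for X
    unfolding image_image using eq that by (intro image_cong) auto
  have "rel_interior e \<subseteq> \<tau>" using assms(3) rel_interior_subset by blast
  then show ?thesis
    by (simp add: image assms(3) rel_interior_translation rel_interior_convex_linear_image[OF f assms(2)])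
qed

definition glue :: "'a pairings \<Rightarrow> 'a \<Rightarrow> 'a \<Rightarrow> bool" where
  "glue \<Phi> u v \<longleftrightarrow> (\<exists>(\<tau>, \<delta>, \<phi>)\<in>\<Phi>. u \<in> \<tau> \<and> v = \<phi> u)"

definition glue_edges :: "'a::euclidean_space pairings \<Rightarrow> 'a set \<Rightarrow> 'a set \<Rightarrow> bool" where
  "glue_edges \<Phi> e e' \<longleftrightarrow> (\<exists>(\<tau>, \<delta>, \<phi>)\<in>\<Phi>. e edge_of \<tau> \<and> e' = \<phi> ` e)"

lemma quotient_map_of_eq_iff:
  "quotient_map_of \<Phi> x = quotient_map_of \<Phi> y \<longleftrightarrow> equivclp (glue \<Phi>) x y"
proof -
  have "quotient_map_of \<Phi> x = {y. equivclp (glue \<Phi>) x y}" for x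
    unfolding quotient_map_of_def glue_def ..
  then show ?thesis
    using equivp_evquivclp[of "glue \<Phi>"] unfolding equivp_def by auto
qed

lemma edge_of_facet_trans:
  assumes "\<tau> facet_of \<sigma>" "e edge_of \<tau>"
  shows "e edge_of \<sigma>"
  using assms face_of_trans unfolding facet_of_def edge_of_def by blast

locale triangulated_pseudo_manifold =
  fixes S :: "'a::euclidean_space set set" and \<Phi> :: "'a pairings"
  assumes pseudo_manifold: "pseudo_manifold S \<Phi>"
begin

lemma finite_S [simp]: "finite S"
  and simplex_S: "\<sigma> \<in> S \<Longrightarrow> 3 simplex \<sigma>"
  using pseudo_manifold unfolding pseudo_manifold_def by (fast, fast)

lemma same_tetrahedron:
  assumes "\<sigma> \<in> S" "\<sigma>' \<in> S" "x \<in> \<sigma>" "x \<in> \<sigma>'"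
  shows "\<sigma> = \<sigma>'"
proof (rule ccontr)
  assume "\<sigma> \<noteq> \<sigma>'"
  moreover have "pairwise disjnt S"
    using pseudo_manifold unfolding pseudo_manifold_def by (elim conjE)
  ultimately have "disjnt \<sigma> \<sigma>'" using assms(1,2) by (simp add: pairwiseD)
  then show False using assms(3,4) unfolding disjnt_def by blast
qed

lemma edge_nonempty: "e edge_of \<sigma> \<Longrightarrow> e \<noteq> {}"
  unfolding edge_of_def by auto

lemma same_tetrahedron_edge:
  assumes "\<sigma> \<in> S" "\<sigma>' \<in> S" "e edge_of \<sigma>" "e edge_of \<sigma>'"
  shows "\<sigma> = \<sigma>'"
proof -
  obtain x where "x \<in> e" using edge_nonempty[OF assms(3)] by blast
  then show ?thesis
    using same_tetrahedron assms(1,2) edge_of_imp_subset[OF assms(3)] edge_of_imp_subset[OF assms(4)]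
    by blast
qed

lemma pairing:
  assumes "(\<tau>, \<delta>, \<phi>) \<in> \<Phi>"
  shows "\<tau> \<in> all_faces S" "\<delta> \<in> all_faces S" "\<tau> \<noteq> \<delta>" "affine_iso \<phi> \<tau> \<delta>"
proof -
  have "\<forall>(\<tau>, \<delta>, \<phi>)\<in>\<Phi>. \<tau> \<in> all_faces S \<and> \<delta> \<in> all_faces S \<and> \<tau> \<noteq> \<delta> \<and> affine_iso \<phi> \<tau> \<delta>"
    using pseudo_manifold unfolding pseudo_manifold_def by (elim conjE)
  with assms show "\<tau> \<in> all_faces S" "\<delta> \<in> all_faces S" "\<tau> \<noteq> \<delta>" "affine_iso \<phi> \<tau> \<delta>"
    by auto
qed

lemma pairing_unique:
  assumes "(\<tau>, \<delta>, \<phi>) \<in> \<Phi>" "(\<tau>', \<delta>', \<phi>') \<in> \<Phi>" "{\<tau>, \<delta>} \<inter> {\<tau>', \<delta>'} \<noteq> {}"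
  shows "\<tau>' = \<tau>" "\<delta>' = \<delta>" "\<phi>' = \<phi>"
proof -
  have "pairwise (\<lambda>(\<tau>, \<delta>, \<phi>) (\<tau>', \<delta>', \<phi>'). {\<tau>, \<delta>} \<inter> {\<tau>', \<delta>'} = {}) \<Phi>"
    using pseudo_manifold unfolding pseudo_manifold_def by (elim conjE)
  from pairwiseD[OF this assms(1,2)] assms(3)
  have "(\<tau>', \<delta>', \<phi>') = (\<tau>, \<delta>, \<phi>)" by auto
  then show "\<tau>' = \<tau>" "\<delta>' = \<delta>" "\<phi>' = \<phi>" by simp_all
qed

text \<open>
  The vertices of the face \<open>\<delta>\<close> are extreme points of the hull of the images of the vertices of \<open>\<tau>\<close>,
  hence they are such images, and by counting \<open>\<phi>\<close> is a bijection between the two triples. So the two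
  tetrahedra at a pairing can be labelled compatibly.
\<close>

lemma pairing_tetrahedra:
  assumes "(\<tau>, \<delta>, \<phi>) \<in> \<Phi>"
  obtains \<sigma> \<sigma>' a b c d d' where "\<sigma> \<in> S" "\<sigma>' \<in> S"
    "tetrahedron a b c d \<sigma>" "\<tau> = convex hull {a,b,c}" "\<tau> facet_of \<sigma>"
    "tetrahedron (\<phi> a) (\<phi> b) (\<phi> c) d' \<sigma>'" "\<delta> = convex hull {\<phi> a, \<phi> b, \<phi> c}" "\<delta> facet_of \<sigma>'"
    "\<phi> ` (convex hull {a,b}) = convex hull {\<phi> a, \<phi> b}"
    "\<phi> ` (convex hull {a,c}) = convex hull {\<phi> a, \<phi> c}"
    "\<phi> ` (convex hull {b,c}) = convex hull {\<phi> b, \<phi> c}"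
proof -
  obtain \<sigma> \<sigma>' where \<sigma>: "\<sigma> \<in> S" "\<tau> facet_of \<sigma>" and \<sigma>': "\<sigma>' \<in> S" "\<delta> facet_of \<sigma>'"
    using pairing[OF assms] unfolding all_faces_def by blast
  obtain a b c d where t: "tetrahedron a b c d \<sigma>" and \<tau>: "\<tau> = convex hull {a,b,c}"
    using tetrahedron_facet \<sigma> simplex_S by blast
  obtain a' b' c' d' where t': "tetrahedron a' b' c' d' \<sigma>'" and \<delta>: "\<delta> = convex hull {a',b',c'}"
    using tetrahedron_facet \<sigma>' simplex_S by blast
  interpret t': tetrahedron a' b' c' d' \<sigma>' by fact
  have iso: "affine_iso \<phi> \<tau> \<delta>" by (rule pairing(4)[OF assms])
  have hulls: "\<phi> ` (convex hull X) = convex hull (\<phi> ` X)" if "X \<subseteq> {a,b,c}" for X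
    using hull_mono[OF that] \<tau> by (intro affine_iso_convex_hull[OF iso]) auto
  have "\<phi> ` \<tau> = \<delta>" using iso unfolding affine_iso_def bij_betw_def by blast
  then have \<delta>': "\<delta> = convex hull (\<phi> ` {a,b,c})" using hulls[of "{a,b,c}"] \<tau> by simp
  have indep': "\<not> affine_dependent {a',b',c'}"
    using t'.independent by (rule affine_independent_subset) auto
  have "{a',b',c'} = {x. x extreme_point_of \<delta>}"
    unfolding \<delta> extreme_point_of_convex_hull_affine_independent[OF indep'] by auto
  also have "\<dots> \<subseteq> \<phi> ` {a,b,c}"
    unfolding \<delta>' by (rule extreme_points_of_convex_hull)
  finally have sub: "{a',b',c'} \<subseteq> \<phi> ` {a,b,c}" .
  have "card (\<phi> ` {a,b,c}) \<le> card {a,b,c}"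
    by (rule card_image_le) simp
  also have "\<dots> \<le> 3"
    using tetrahedron.distinct[OF t] by simp
  also have "3 = card {a',b',c'}" by simp
  finally have eq: "{a',b',c'} = \<phi> ` {a,b,c}"
    using sub by (intro card_seteq) auto
  then have card: "card {\<phi> a, \<phi> b, \<phi> c} = 3"
    using \<open>3 = card {a',b',c'}\<close> by simp
  have neq: "\<phi> a \<noteq> \<phi> b" "\<phi> a \<noteq> \<phi> c" "\<phi> b \<noteq> \<phi> c"
    using card by (auto simp: card_insert_if split: if_splits)
  have d': "d' \<notin> \<phi> ` {a,b,c}" unfolding eq[symmetric] by simp
  have "tetrahedron (\<phi> a) (\<phi> b) (\<phi> c) d' \<sigma>'"
  proof (rule tetrahedron_relabel[OF t'])
    show "distinct [\<phi> a, \<phi> b, \<phi> c, d']" using neq d' by auto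
    have "{\<phi> a, \<phi> b, \<phi> c, d'} = insert d' (\<phi> ` {a,b,c})" by auto
    then show "{\<phi> a, \<phi> b, \<phi> c, d'} = {a', b', c', d'}" unfolding eq[symmetric] by auto
  qed
  moreover have "\<delta> = convex hull {\<phi> a, \<phi> b, \<phi> c}" using \<delta>' by simp
  ultimately show thesis
    using that[OF \<sigma>(1) \<sigma>'(1) t \<tau> \<sigma>(2) _ _ \<sigma>'(2)] hulls[of "{a,b}"] hulls[of "{a,c}"] hulls[of "{b,c}"]
    by simp
qed

lemma edges_of_glued_face:
  assumes "(\<tau>, \<delta>, \<phi>) \<in> \<Phi>"
  shows "{e. e edge_of \<delta>} = (`) \<phi> ` {e. e edge_of \<tau>}"
proof (rule pairing_tetrahedra[OF assms])
  fix \<sigma> \<sigma>' a b c d d'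
  assume "tetrahedron a b c d \<sigma>" and \<tau>: "\<tau> = convex hull {a,b,c}"
    and "tetrahedron (\<phi> a) (\<phi> b) (\<phi> c) d' \<sigma>'" and \<delta>: "\<delta> = convex hull {\<phi> a, \<phi> b, \<phi> c}"
    and im: "\<phi> ` (convex hull {a,b}) = convex hull {\<phi> a, \<phi> b}"
    "\<phi> ` (convex hull {a,c}) = convex hull {\<phi> a, \<phi> c}"
    "\<phi> ` (convex hull {b,c}) = convex hull {\<phi> b, \<phi> c}"
  interpret t: tetrahedron a b c d \<sigma> by fact
  interpret t': tetrahedron "\<phi> a" "\<phi> b" "\<phi> c" d' \<sigma>' by fact
  show ?thesis
    unfolding \<tau> \<delta> t.edges_abc t'.edges_abc by (simp only: image_insert image_empty im)
qed

lemma glue_edge: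
  assumes "(\<tau>, \<delta>, \<phi>) \<in> \<Phi>" "e edge_of \<tau>"
  shows "\<phi> ` e edge_of \<delta>"
  using edges_of_glued_face[OF assms(1)] assms(2) by blast

lemma glue_edge_inverse:
  assumes "(\<tau>, \<delta>, \<phi>) \<in> \<Phi>" "e edge_of \<delta>"
  shows "\<exists>e'. e' edge_of \<tau> \<and> e = \<phi> ` e'"
  using edges_of_glued_face[OF assms(1)] assms(2) by blast

lemma all_faces_edge: "\<tau> \<in> all_faces S \<Longrightarrow> e edge_of \<tau> \<Longrightarrow> e \<in> all_edges S"
  unfolding all_faces_def all_edges_def using edge_of_facet_trans by blast

text \<open>
  A face that contains an interior point of an edge contains the whole edge. This rigidity makes the
  identification of points inside edges a matter of identifying edges.
\<close>

lemma edge_meeting_face: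
  assumes "\<tau> \<in> all_faces S" "e \<in> all_edges S" "x \<in> \<tau>" "x \<in> rel_interior e"
  shows "e edge_of \<tau>"
proof -
  obtain \<sigma> \<sigma>' where \<sigma>: "\<sigma> \<in> S" "\<tau> facet_of \<sigma>" and \<sigma>': "\<sigma>' \<in> S" "e edge_of \<sigma>'"
    using assms unfolding all_faces_def all_edges_def by blast
  have "x \<in> \<sigma>" using facet_of_imp_subset[OF \<sigma>(2)] assms(3) by blast
  moreover have "x \<in> \<sigma>'"
    using edge_of_imp_subset[OF \<sigma>'(2)] rel_interior_subset[of e] assms(4) by blast
  ultimately have "\<sigma> = \<sigma>'" by (rule same_tetrahedron[OF \<sigma>(1) \<sigma>'(1)])
  with \<sigma>' have e: "e edge_of \<sigma>" by simp
  have "e \<subseteq> \<tau>"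
    using subset_of_face_of[of \<tau> \<sigma> e] \<sigma>(2) e assms(3,4)
    unfolding facet_of_def by (auto dest: edge_of_imp_subset)
  then show ?thesis using edge_of_facet[OF \<sigma>(2) e] by blast
qed

lemma edge_meeting_edge:
  assumes "e \<in> all_edges S" "e' \<in> all_edges S" "x \<in> e" "x \<in> rel_interior e'"
  shows "e' = e"
proof -
  obtain \<sigma> \<sigma>' where \<sigma>: "\<sigma> \<in> S" "e edge_of \<sigma>" and \<sigma>': "\<sigma>' \<in> S" "e' edge_of \<sigma>'"
    using assms unfolding all_edges_def by blast
  have "x \<in> \<sigma>" using edge_of_imp_subset[OF \<sigma>(2)] assms(3) by blast
  moreover have "x \<in> \<sigma>'"
    using edge_of_imp_subset[OF \<sigma>'(2)] rel_interior_subset[of e'] assms(4) by blast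
  ultimately have "\<sigma> = \<sigma>'" by (rule same_tetrahedron[OF \<sigma>(1) \<sigma>'(1)])
  with \<sigma>' have e': "e' edge_of \<sigma>" by simp
  have sub: "e' \<subseteq> e"
    using subset_of_face_of[of e \<sigma> e'] \<sigma>(2) e' assms(3,4)
    unfolding edge_of_def by (auto dest: face_of_imp_subset)
  have "e face_of \<sigma>" "e' face_of \<sigma>" "aff_dim e = 1" "aff_dim e' = 1"
    using e' \<sigma>(2) unfolding edge_of_def by blast+
  moreover have "e' face_of e"
    using calculation sub by (meson face_of_face)
  moreover have "convex e" using calculation(1) by (rule face_of_imp_convex)
  ultimately show "e' = e" using face_of_aff_dim_lt by fastforce
qed

lemma convex_all_edges: "e \<in> all_edges S \<Longrightarrow> convex e"
  unfolding all_edges_def edge_of_def by (auto dest: face_of_imp_convex)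

lemma edge_rel_interior_nonempty: "e \<in> all_edges S \<Longrightarrow> rel_interior e \<noteq> {}"
  using rel_interior_eq_empty convex_all_edges edge_nonempty unfolding all_edges_def by blast

text \<open>
  Along a chain of gluings that starts inside an edge, each gluing moves the point together with the edge
  whose interior it lies in. This lifts the chain from points to edges.
\<close>

lemma point_class_in_edge_class:
  assumes "equivclp (glue \<Phi>) x y" "e \<in> all_edges S" "x \<in> rel_interior e"
  shows "\<exists>e'\<in>all_edges S. y \<in> rel_interior e' \<and> equivclp (glue_edges \<Phi>) e e'"
  using assms(1)
proof (induction rule: equivclp_induct)
  case base
  then show ?case using assms(2,3) by (meson equivclp_refl)
next
  case (step y z)
  then obtain e' where e': "e' \<in> all_edges S" "y \<in> rel_interior e'" "equivclp (glue_edges \<Phi>) e e'"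
    by blast
  from step(2) show ?case
  proof
    assume "glue \<Phi> y z"
    then obtain \<tau> \<delta> \<phi> where g: "(\<tau>, \<delta>, \<phi>) \<in> \<Phi>" "y \<in> \<tau>" "z = \<phi> y"
      unfolding glue_def by blast
    have et: "e' edge_of \<tau>"
      using edge_meeting_face[OF pairing(1)[OF g(1)] e'(1) g(2) e'(2)] .
    have "\<phi> ` e' \<in> all_edges S"
      using all_faces_edge[OF pairing(2)[OF g(1)]] glue_edge[OF g(1) et] by blast
    moreover have "z \<in> rel_interior (\<phi> ` e')"
      using affine_iso_rel_interior[OF pairing(4)[OF g(1)] convex_all_edges[OF e'(1)]]
        edge_of_imp_subset[OF et] e'(2) g(3) by blast
    moreover have "glue_edges \<Phi> e' (\<phi> ` e')"
      unfolding glue_edges_def using g(1) et by blast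
    ultimately show ?thesis using e'(3) equivclp_into_equivclp by metis
  next
    assume "glue \<Phi> z y"
    then obtain \<tau> \<delta> \<phi> where g: "(\<tau>, \<delta>, \<phi>) \<in> \<Phi>" "z \<in> \<tau>" "y = \<phi> z"
      unfolding glue_def by blast
    have bij: "bij_betw \<phi> \<tau> \<delta>" using pairing(4)[OF g(1)] unfolding affine_iso_def by blast
    then have "y \<in> \<delta>" using g by (auto simp: bij_betw_def)
    then have "e' edge_of \<delta>"
      using edge_meeting_face[OF pairing(2)[OF g(1)] e'(1) _ e'(2)] by blast
    then obtain e'' where e'': "e'' edge_of \<tau>" "e' = \<phi> ` e''"
      using glue_edge_inverse[OF g(1)] by blast
    have all: "e'' \<in> all_edges S"
      using all_faces_edge[OF pairing(1)[OF g(1)] e''(1)] .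
    have sub: "e'' \<subseteq> \<tau>" using edge_of_imp_subset[OF e''(1)] .
    have "\<phi> z \<in> \<phi> ` rel_interior e''"
      using affine_iso_rel_interior[OF pairing(4)[OF g(1)] convex_all_edges[OF all] sub]
        e'(2) e''(2) g(3) by simp
    then have "z \<in> rel_interior e''"
      using inj_on_image_mem_iff[of \<phi> \<tau> z "rel_interior e''"] bij g(2) sub rel_interior_subset[of e'']
      unfolding bij_betw_def by blast
    moreover have "glue_edges \<Phi> e'' e'"
      unfolding glue_edges_def using g(1) e'' by blast
    ultimately show ?thesis using e'(3) equivclp_into_equivclp all by metis
  qed
qed

lemma glue_edges_cell_image:
  assumes "glue_edges \<Phi> e e'"
  shows "e \<in> all_edges S" "e' \<in> all_edges S" "cell_image \<Phi> e = cell_image \<Phi> e'"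
proof -
  obtain \<tau> \<delta> \<phi> where g: "(\<tau>, \<delta>, \<phi>) \<in> \<Phi>" "e edge_of \<tau>" "e' = \<phi> ` e"
    using assms unfolding glue_edges_def by blast
  show "e \<in> all_edges S" using all_faces_edge[OF pairing(1)[OF g(1)] g(2)] .
  show "e' \<in> all_edges S"
    using all_faces_edge[OF pairing(2)[OF g(1)]] glue_edge[OF g(1,2)] g(3) by blast
  have "quotient_map_of \<Phi> x = quotient_map_of \<Phi> (\<phi> x)" if "x \<in> e" for x
  proof -
    have "glue \<Phi> x (\<phi> x)"
      unfolding glue_def using g(1) edge_of_imp_subset[OF g(2)] that by blast
    then show ?thesis unfolding quotient_map_of_eq_iff by (rule r_into_equivclp)
  qed
  then show "cell_image \<Phi> e = cell_image \<Phi> e'"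
    unfolding cell_image_def g(3) image_image by (intro image_cong) auto
qed

lemma cell_image_eq_imp_equiv:
  assumes "e \<in> all_edges S" "e' \<in> all_edges S" "cell_image \<Phi> e = cell_image \<Phi> e'"
  shows "equivclp (glue_edges \<Phi>) e e'"
proof -
  obtain x where x: "x \<in> rel_interior e" using edge_rel_interior_nonempty[OF assms(1)] by blast
  then have "quotient_map_of \<Phi> x \<in> cell_image \<Phi> e'"
    using rel_interior_subset assms(3) unfolding cell_image_def by blast
  then obtain y where y: "y \<in> e'" "equivclp (glue \<Phi>) x y"
    unfolding cell_image_def quotient_map_of_eq_iff[symmetric] by blast
  obtain e'' where "e''\<in>all_edges S" "y \<in> rel_interior e''" "equivclp (glue_edges \<Phi>) e e''"
    using point_class_in_edge_class[OF y(2) assms(1) x] by blast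
  then show ?thesis using edge_meeting_edge[OF assms(2) _ y(1)] by blast
qed

lemma equiv_imp_cell_image_eq:
  assumes "equivclp (glue_edges \<Phi>) e e'"
  shows "cell_image \<Phi> e = cell_image \<Phi> e'"
  using assms by (induction rule: equivclp_induct) (auto dest: glue_edges_cell_image(3))

text \<open>
  An interior point of the edge decides: if its class meets an unpaired face, then an edge over the same
  image runs through that face and lies in it.
\<close>

lemma edge_in_boundary_iff:
  assumes "e \<in> all_edges S"
  shows "cell_image \<Phi> e \<subseteq> K_boundary S \<Phi> \<longleftrightarrow>
    (\<exists>e'\<in>edges_over S \<Phi> (cell_image \<Phi> e). \<exists>\<tau>\<in>unpaired_faces S \<Phi>. e' edge_of \<tau>)"
proof
  assume sub: "cell_image \<Phi> e \<subseteq> K_boundary S \<Phi>"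
  obtain x where x: "x \<in> rel_interior e" using edge_rel_interior_nonempty[OF assms(1)] by blast
  then have "quotient_map_of \<Phi> x \<in> K_boundary S \<Phi>"
    using rel_interior_subset sub unfolding cell_image_def by blast
  then obtain \<tau> y where \<tau>: "\<tau> \<in> unpaired_faces S \<Phi>" "y \<in> \<tau>" "equivclp (glue \<Phi>) x y"
    unfolding K_boundary_def cell_image_def quotient_map_of_eq_iff[symmetric] by blast
  obtain e' where e': "e' \<in> all_edges S" "y \<in> rel_interior e'" "equivclp (glue_edges \<Phi>) e e'"
    using point_class_in_edge_class[OF \<tau>(3) assms(1) x] by blast
  have "e' edge_of \<tau>"
    using edge_meeting_face[OF _ e'(1) \<tau>(2) e'(2)] \<tau>(1) unfolding unpaired_faces_def by blast
  then show "\<exists>e'\<in>edges_over S \<Phi> (cell_image \<Phi> e). \<exists>\<tau>\<in>unpaired_faces S \<Phi>. e' edge_of \<tau>"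
    using e' \<tau>(1) equiv_imp_cell_image_eq[OF e'(3)] unfolding edges_over_def by auto
next
  assume "\<exists>e'\<in>edges_over S \<Phi> (cell_image \<Phi> e). \<exists>\<tau>\<in>unpaired_faces S \<Phi>. e' edge_of \<tau>"
  then obtain e' \<tau> where e': "cell_image \<Phi> e' = cell_image \<Phi> e" "\<tau> \<in> unpaired_faces S \<Phi>" "e' edge_of \<tau>"
    unfolding edges_over_def by blast
  have "cell_image \<Phi> e' \<subseteq> cell_image \<Phi> \<tau>"
    unfolding cell_image_def using edge_of_imp_subset[OF e'(3)] by blast
  then show "cell_image \<Phi> e \<subseteq> K_boundary S \<Phi>"
    unfolding K_boundary_def using e' by blast
qed

lemma finite_edges_of: "\<sigma> \<in> S \<Longrightarrow> finite {e. e edge_of \<sigma>}"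
  using tetrahedron_exists[OF simplex_S, of \<sigma>] by (auto simp: tetrahedron.edges)

lemma finite_facets_of: "\<sigma> \<in> S \<Longrightarrow> finite {\<tau>. \<tau> facet_of \<sigma>}"
  using tetrahedron_exists[OF simplex_S, of \<sigma>] by (auto simp: tetrahedron.facets)

lemma finite_all_edges [simp]: "finite (all_edges S)"
proof -
  have "all_edges S = (\<Union>\<sigma>\<in>S. {e. e edge_of \<sigma>})" unfolding all_edges_def by blast
  then show ?thesis using finite_edges_of by simp
qed

lemma finite_all_faces [simp]: "finite (all_faces S)"
proof -
  have "all_faces S = (\<Union>\<sigma>\<in>S. {\<tau>. \<tau> facet_of \<sigma>})" unfolding all_faces_def by blast
  then show ?thesis using finite_facets_of by simp
qed

lemma finite_unpaired_faces [simp]: "finite (unpaired_faces S \<Phi>)"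
  unfolding unpaired_faces_def by simp

lemma finite_edges_over [simp]: "finite (edges_over S \<Phi> e)"
  unfolding edges_over_def by simp

lemma card_faces_containing_edge:
  assumes "e \<in> all_edges S"
  shows "card {\<tau> \<in> all_faces S. e edge_of \<tau>} = 2"
proof -
  obtain \<sigma> where \<sigma>: "\<sigma> \<in> S" "e edge_of \<sigma>" using assms unfolding all_edges_def by blast
  have "\<tau> \<in> all_faces S \<and> e edge_of \<tau> \<longleftrightarrow> \<tau> facet_of \<sigma> \<and> e \<subseteq> \<tau>" for \<tau>
  proof
    assume \<tau>: "\<tau> \<in> all_faces S \<and> e edge_of \<tau>"
    then obtain \<sigma>' where \<sigma>': "\<sigma>' \<in> S" "\<tau> facet_of \<sigma>'" unfolding all_faces_def by blast
    then have "\<sigma> = \<sigma>'"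
      using same_tetrahedron_edge[OF \<sigma>(1) \<sigma>'(1) \<sigma>(2)] edge_of_facet_trans[OF \<sigma>'(2)] \<tau> by blast
    then show "\<tau> facet_of \<sigma> \<and> e \<subseteq> \<tau>"
      using \<sigma>'(2) \<tau> edge_of_imp_subset[of e \<tau>] by blast
  next
    assume \<tau>: "\<tau> facet_of \<sigma> \<and> e \<subseteq> \<tau>"
    then show "\<tau> \<in> all_faces S \<and> e edge_of \<tau>"
      using edge_of_facet[of \<tau> \<sigma> e] \<sigma> unfolding all_faces_def by blast
  qed
  then have "{\<tau> \<in> all_faces S. e edge_of \<tau>} = {\<tau>. \<tau> facet_of \<sigma> \<and> e \<subseteq> \<tau>}" by blast
  then show ?thesis using card_facets_containing_edge[OF simplex_S[OF \<sigma>(1)] \<sigma>(2)] by simp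
qed

text \<open>
  Take the tetrahedron edges over \<open>e\<close> as vertices of a multigraph. The two faces at such an edge are its
  half-edges, and each pairing of faces joins two of them. The graph is connected because all its vertices
  have the same image, and its free half-edges are the flags consisting of an edge over \<open>e\<close> and an unpaired face.
\<close>

lemma card_boundary_flags:
  assumes "e \<in> K_edges S \<Phi>"
  shows "card {(e', \<tau>). e' \<in> edges_over S \<Phi> e \<and> \<tau> \<in> unpaired_faces S \<Phi> \<and> e' edge_of \<tau>} =
    (if e \<subseteq> K_boundary S \<Phi> then 2 else 0)" (is "card ?U = _")
proof -
  define V where "V = edges_over S \<Phi> e"
  define H where "H = (SIGMA e':V. {\<tau> \<in> all_faces S. e' edge_of \<tau>})"
  define M where "M = {(e', g). e' \<in> V \<and> g \<in> \<Phi> \<and> e' edge_of fst g}"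
  \<comment> \<open>The half-edges joined by a pairing \<open>g = (\<tau>, \<delta>, \<phi>)\<close> at \<open>e'\<close>: the flag \<open>(e', \<tau>)\<close> and its image \<open>(\<phi> ` e', \<delta>)\<close>.\<close>
  define h where "h = (\<lambda>(e' :: 'a set, g :: 'a set \<times> 'a set \<times> ('a \<Rightarrow> 'a)). (e', fst g))"
  define k where "k = (\<lambda>(e' :: 'a set, g :: 'a set \<times> 'a set \<times> ('a \<Rightarrow> 'a)). (snd (snd g) ` e', fst (snd g)))"
  have VI: "e' \<in> V \<longleftrightarrow> e' \<in> all_edges S \<and> cell_image \<Phi> e' = e" for e'
    unfolding V_def edges_over_def by simp
  have glue_V: "e' \<in> V \<longleftrightarrow> e'' \<in> V" if "glue_edges \<Phi> e' e''" for e' e''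
    using glue_edges_cell_image[OF that] unfolding VI by simp
  have M_iff: "(e', (\<tau>,\<delta>,\<phi>)) \<in> M \<longleftrightarrow> e' \<in> V \<and> (\<tau>,\<delta>,\<phi>) \<in> \<Phi> \<and> e' edge_of \<tau>" for e' \<tau> \<delta> \<phi>
    unfolding M_def by simp
  have M_glue: "glue_edges \<Phi> e' (\<phi> ` e')" if "(e', (\<tau>,\<delta>,\<phi>)) \<in> M" for e' \<tau> \<delta> \<phi>
    using that unfolding M_iff glue_edges_def by blast
  have finV: "finite V" unfolding V_def by simp
  have finH: "finite H" unfolding H_def using finV by (intro finite_SigmaI) auto
  have cardH: "card H = 2 * card V"
    unfolding H_def using finV card_faces_containing_edge VI by simp
  have "card (H - h ` M - k ` M) \<in> {0,2}"
  proof (rule card_free_half_edges[where V = V and src = fst and tgt = "\<lambda>m. fst (k m)"])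
    fix m assume m: "m \<in> M"
    obtain e' \<tau> \<delta> \<phi> where [simp]: "m = (e', (\<tau>,\<delta>,\<phi>))" by (metis prod.collapse)
    show "fst m \<in> V \<and> fst (k m) \<in> V"
      using m M_glue[of e' \<tau> \<delta> \<phi>] glue_V[of e' "\<phi> ` e'"] M_iff[of e' \<tau> \<delta> \<phi>] unfolding k_def by simp
  next
    fix u v assume uv: "u \<in> V" "v \<in> V"
    let ?R = "\<lambda>x y. \<exists>m\<in>M. fst m = x \<and> fst (k m) = y"
    have R: "?R x y" if "glue_edges \<Phi> x y" "x \<in> V" for x y
    proof -
      obtain \<tau> \<delta> \<phi> where "(\<tau>,\<delta>,\<phi>) \<in> \<Phi>" "x edge_of \<tau>" "y = \<phi> ` x"
        using \<open>glue_edges \<Phi> x y\<close> unfolding glue_edges_def by blast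
      then show ?thesis
        using M_iff that(2) unfolding k_def by (intro bexI[of _ "(x, (\<tau>,\<delta>,\<phi>))"]) auto
    qed
    have "equivclp (glue_edges \<Phi>) u v"
      using uv cell_image_eq_imp_equiv unfolding VI by simp
    then have "v \<in> V \<and> equivclp ?R u v"
    proof (induction rule: equivclp_induct)
      case base
      then show ?case using uv by simp
    next
      case (step y z)
      then have "z \<in> V" using glue_V by blast
      moreover have "?R y z \<or> ?R z y" using step R calculation by blast
      ultimately show ?case using step equivclp_into_equivclp[of ?R u y z] by blast
    qed
    then show "equivclp ?R u v" by blast
  next
    show "h ` M \<subseteq> H"
      unfolding h_def M_def H_def using pairing(1) by fastforce
    show "k ` M \<subseteq> H"
    proof
      fix f assume "f \<in> k ` M"
      then obtain e' \<tau> \<delta> \<phi> where m: "(e', (\<tau>,\<delta>,\<phi>)) \<in> M" and f: "f = (\<phi> ` e', \<delta>)"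
        unfolding k_def by auto
      then show "f \<in> H"
        using M_glue[OF m] glue_V[of e' "\<phi> ` e'"] pairing(2)[of \<tau> \<delta> \<phi>] glue_edge[of \<tau> \<delta> \<phi> e']
        unfolding M_iff H_def by auto
    qed
    show "inj_on h M"
    proof (rule inj_onI)
      fix m m' assume mm: "m \<in> M" "m' \<in> M" "h m = h m'"
      obtain e' \<tau> \<delta> \<phi> where [simp]: "m = (e', (\<tau>,\<delta>,\<phi>))" by (metis prod.collapse)
      obtain e'' \<tau>' \<delta>' \<phi>' where [simp]: "m' = (e'', (\<tau>',\<delta>',\<phi>'))" by (metis prod.collapse)
      have g: "(\<tau>,\<delta>,\<phi>) \<in> \<Phi>" "(\<tau>',\<delta>',\<phi>') \<in> \<Phi>" "\<tau> = \<tau>'" "e' = e''"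
        using mm by (simp_all add: M_iff h_def)
      have "{\<tau>, \<delta>} \<inter> {\<tau>', \<delta>'} \<noteq> {}" using g(3) by blast
      from pairing_unique[OF g(1,2) this] show "m = m'" using g(4) by simp
    qed
    show "inj_on k M"
    proof (rule inj_onI)
      fix m m' assume mm: "m \<in> M" "m' \<in> M" "k m = k m'"
      obtain e' \<tau> \<delta> \<phi> where [simp]: "m = (e', (\<tau>,\<delta>,\<phi>))" by (metis prod.collapse)
      obtain e'' \<tau>' \<delta>' \<phi>' where [simp]: "m' = (e'', (\<tau>',\<delta>',\<phi>'))" by (metis prod.collapse)
      have g': "(\<tau>,\<delta>,\<phi>) \<in> \<Phi>" "(\<tau>',\<delta>',\<phi>') \<in> \<Phi>" "\<delta> = \<delta>'"
        using mm by (simp_all add: M_iff k_def)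
      have "{\<tau>, \<delta>} \<inter> {\<tau>', \<delta>'} \<noteq> {}" using g'(3) by blast
      note eq = pairing_unique[OF g'(1,2) this]
      have g: "(\<tau>,\<delta>,\<phi>) \<in> \<Phi>" "e' edge_of \<tau>" "e'' edge_of \<tau>" "\<phi> ` e' = \<phi> ` e''"
        using mm eq by (simp_all add: M_iff k_def)
      have sub: "e' \<subseteq> \<tau>" "e'' \<subseteq> \<tau>" using g(2,3) by (simp_all only: edge_of_imp_subset)
      have "inj_on \<phi> \<tau>" using pairing(4)[OF g(1)] unfolding affine_iso_def bij_betw_def by blast
      then have "e' = e''" using inj_on_image_eq_iff[OF _ sub] g(4) by blast
      then show "m = m'" using eq by simp
    qed
    show "h ` M \<inter> k ` M = {}"
    proof (rule ccontr)
      assume "\<not> ?thesis"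
      then obtain f where "f \<in> h ` M" "f \<in> k ` M" by blast
      then obtain m m' where mm: "m \<in> M" "m' \<in> M" "h m = k m'" by (elim imageE) simp
      obtain e' \<tau> \<delta> \<phi> where [simp]: "m = (e', (\<tau>,\<delta>,\<phi>))" by (metis prod.collapse)
      obtain e'' \<tau>' \<delta>' \<phi>' where [simp]: "m' = (e'', (\<tau>',\<delta>',\<phi>'))" by (metis prod.collapse)
      have g: "(\<tau>,\<delta>,\<phi>) \<in> \<Phi>" "(\<tau>',\<delta>',\<phi>') \<in> \<Phi>" "\<tau> = \<delta>'"
        using mm by (simp_all add: M_iff h_def k_def)
      have "{\<tau>, \<delta>} \<inter> {\<tau>', \<delta>'} \<noteq> {}" using g(3) by blast
      from pairing_unique(2)[OF g(1,2) this] show False using g(3) pairing(3)[OF g(1)] by simp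
    qed
  qed (rule finV finH cardH)+
  moreover have "H - h ` M - k ` M = ?U"
  proof (rule set_eqI)
    fix f :: "'a set \<times> 'a set"
    obtain e' \<tau> where [simp]: "f = (e', \<tau>)" by (metis prod.collapse)
    have hM: "f \<in> h ` M \<longleftrightarrow> e' \<in> V \<and> e' edge_of \<tau> \<and> (\<exists>\<delta> \<phi>. (\<tau>,\<delta>,\<phi>) \<in> \<Phi>)"
      unfolding h_def M_def by (auto simp: image_iff)
    have kM: "f \<in> k ` M \<longleftrightarrow> e' \<in> V \<and> e' edge_of \<tau> \<and> (\<exists>\<tau>' \<phi>. (\<tau>',\<tau>,\<phi>) \<in> \<Phi>)"
    proof
      assume "f \<in> k ` M"
      then obtain e'' \<tau>' \<phi> where m: "(e'', (\<tau>',\<tau>,\<phi>)) \<in> M" and f: "e' = \<phi> ` e''"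
        unfolding k_def by auto
      then show "e' \<in> V \<and> e' edge_of \<tau> \<and> (\<exists>\<tau>' \<phi>. (\<tau>',\<tau>,\<phi>) \<in> \<Phi>)"
        using M_glue[OF m] glue_V[of e'' "\<phi> ` e''"] glue_edge[of \<tau>' \<tau> \<phi> e'']
        unfolding M_iff by auto
    next
      assume *: "e' \<in> V \<and> e' edge_of \<tau> \<and> (\<exists>\<tau>' \<phi>. (\<tau>',\<tau>,\<phi>) \<in> \<Phi>)"
      then obtain \<tau>' \<phi> where g: "(\<tau>',\<tau>,\<phi>) \<in> \<Phi>" by blast
      then obtain e'' where e'': "e'' edge_of \<tau>'" "e' = \<phi> ` e''"
        using glue_edge_inverse * by blast
      then have "e'' \<in> V" using glue_V[of e'' e'] * g unfolding glue_edges_def by blast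
      then have "(e'', (\<tau>',\<tau>,\<phi>)) \<in> M" using M_iff g e'' by blast
      moreover have "f = k (e'', (\<tau>',\<tau>,\<phi>))" using e'' unfolding k_def by simp
      ultimately show "f \<in> k ` M" by blast
    qed
    show "f \<in> H - h ` M - k ` M \<longleftrightarrow> f \<in> ?U"
      unfolding Diff_iff hM kM unfolding H_def V_def unpaired_faces_def by auto
  qed
  ultimately have card_U: "card ?U \<in> {0,2}" by simp
  have "finite ?U"
    using finH by (rule rev_finite_subset) (auto simp: H_def V_def unpaired_faces_def)
  then have "card ?U = 0 \<longleftrightarrow> ?U = {}" by simp
  moreover have "e \<subseteq> K_boundary S \<Phi> \<longleftrightarrow> ?U \<noteq> {}"
  proof -
    obtain e0 where "e0 \<in> all_edges S" "e = cell_image \<Phi> e0"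
      using assms unfolding K_edges_def by blast
    then show ?thesis using edge_in_boundary_iff[of e0] by blast
  qed
  ultimately show ?thesis using card_U by auto
qed

section \<open>Edge weights\<close>

abbreviation discs :: "'a disc set" where "discs \<equiv> quad_types S \<union> triangle_types S"

text \<open>The number of points, with multiplicity, in which a normal surface with coordinates \<open>s\<close> meets an edge.\<close>

definition edge_weight :: "('a disc \<Rightarrow> real) \<Rightarrow> 'a set \<Rightarrow> real" where
  "edge_weight s e = (\<Sum>D\<in>{D \<in> discs. e \<in> disc_edges D}. s D)"

lemma discs_in_tet: "D \<in> discs_in \<sigma> \<Longrightarrow> disc_tet D = \<sigma>"
  unfolding discs_in_def quads_in_def triangles_in_def by auto

lemma discs_eq: "discs = (\<Union>\<sigma>\<in>S. discs_in \<sigma>)"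
  unfolding discs_in_def quad_types_def triangle_types_def by blast

lemma finite_discs_in: "\<sigma> \<in> S \<Longrightarrow> finite (quads_in \<sigma>)" "\<sigma> \<in> S \<Longrightarrow> finite (triangles_in \<sigma>)"
  using tetrahedron_exists[OF simplex_S, of \<sigma>]
  by (auto simp: tetrahedron.quads tetrahedron.triangles)

lemma finite_types [simp]: "finite (quad_types S)" "finite (triangle_types S)"
  unfolding quad_types_def triangle_types_def using finite_discs_in by simp_all

lemma types_disjoint: "quad_types S \<inter> triangle_types S = {}"
  unfolding quad_types_def triangle_types_def quads_in_def triangles_in_def by blast

lemma disc_edges_in: "D \<in> discs_in \<sigma> \<Longrightarrow> e \<in> disc_edges D \<Longrightarrow> e edge_of \<sigma>"
  unfolding discs_in_def quads_in_def triangles_in_def by auto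

lemma disc_edges_subset: "D \<in> discs \<Longrightarrow> disc_edges D \<subseteq> all_edges S"
  unfolding discs_eq all_edges_def using disc_edges_in by blast

lemma discs_meeting_edge:
  assumes "\<sigma> \<in> S" "e edge_of \<sigma>"
  shows "{D \<in> discs. e \<in> disc_edges D} = {D \<in> discs_in \<sigma>. e \<in> disc_edges D}"
proof
  show "{D \<in> discs. e \<in> disc_edges D} \<subseteq> {D \<in> discs_in \<sigma>. e \<in> disc_edges D}"
  proof
    fix D assume D: "D \<in> {D \<in> discs. e \<in> disc_edges D}"
    then obtain \<sigma>' where \<sigma>': "\<sigma>' \<in> S" "D \<in> discs_in \<sigma>'" unfolding discs_eq by blast
    then have "\<sigma>' = \<sigma>"
      using D disc_edges_in[OF \<sigma>'(2)] same_tetrahedron_edge[OF \<sigma>'(1) assms(1) _ assms(2)] by blast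
    then show "D \<in> {D \<in> discs_in \<sigma>. e \<in> disc_edges D}" using D \<sigma>' by blast
  qed
qed (use assms(1) in \<open>auto simp: discs_eq\<close>)

text \<open>
  The edge \<open>ab\<close> is missed by the triangles at \<open>c\<close> and \<open>d\<close> and by the quadrilateral that faces it.
\<close>

lemma edge_weight_tetrahedron:
  assumes "\<sigma> \<in> S" "tetrahedron a b c d \<sigma>"
  shows "edge_weight s (convex hull {a,b}) = s (Triangle \<sigma> a) + s (Triangle \<sigma> b)
    + s (Quad \<sigma> {convex hull {a,c}, convex hull {b,d}})
    + s (Quad \<sigma> {convex hull {a,d}, convex hull {b,c}})"
proof -
  interpret tetrahedron a b c d \<sigma> by fact
  have e: "edge a b edge_of \<sigma>" unfolding edge_of_iff by blast
  have "D \<in> discs_in \<sigma> \<and> edge a b \<in> disc_edges D \<longleftrightarrow>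
      D \<in> {Triangle \<sigma> a, Triangle \<sigma> b, Quad \<sigma> {edge a c, edge b d}, Quad \<sigma> {edge a d, edge b c}}"
    (is "_ \<longleftrightarrow> D \<in> ?X") for D
  proof
    assume "D \<in> discs_in \<sigma> \<and> edge a b \<in> disc_edges D"
    then show "D \<in> ?X"
      unfolding discs_in_def quads triangles Un_iff
      by (elim conjE disjE insertE emptyE) (simp_all only: disc_edges_simps, simp_all add: doubleton_eq_iff)
  next
    assume "D \<in> ?X"
    then show "D \<in> discs_in \<sigma> \<and> edge a b \<in> disc_edges D"
      unfolding discs_in_def quads triangles Un_iff
      by (elim insertE emptyE) (simp_all only: disc_edges_simps, simp_all)
  qed
  then have "{D \<in> discs. edge a b \<in> disc_edges D} = ?X"
    unfolding discs_meeting_edge[OF assms(1) e] by blast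
  then show ?thesis
    unfolding edge_weight_def by (simp add: doubleton_eq_iff)
qed

text \<open>
  Both sides sum over the corners of all discs, grouped by disc and by edge.
\<close>

lemma sum_discs_edges:
  "(\<Sum>D\<in>discs. s D * (\<Sum>e\<in>disc_edges D. f e)) = (\<Sum>e\<in>all_edges S. f e * edge_weight s e)"
proof -
  have "(\<Sum>D\<in>discs. s D * (\<Sum>e\<in>disc_edges D. f e)) =
      (\<Sum>D\<in>discs. \<Sum>e\<in>{e \<in> all_edges S. e \<in> disc_edges D}. s D * f e)"
  proof (rule sum.cong[OF refl])
    fix D assume "D \<in> discs"
    then have "{e \<in> all_edges S. e \<in> disc_edges D} = disc_edges D"
      using disc_edges_subset by blast
    then show "s D * (\<Sum>e\<in>disc_edges D. f e) = (\<Sum>e\<in>{e \<in> all_edges S. e \<in> disc_edges D}. s D * f e)"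
      by (simp add: sum_distrib_left)
  qed
  also have "\<dots> = (\<Sum>e\<in>all_edges S. \<Sum>D\<in>{D \<in> discs. e \<in> disc_edges D}. s D * f e)"
    by (rule sum.swap_restrict) simp_all
  also have "\<dots> = (\<Sum>e\<in>all_edges S. f e * edge_weight s e)"
    unfolding edge_weight_def by (simp add: sum_distrib_left mult.commute)
  finally show ?thesis .
qed

lemma sum_K_edges:
  "(\<Sum>e\<in>K_edges S \<Phi>. \<Sum>e'\<in>edges_over S \<Phi> e. g e e') = (\<Sum>e'\<in>all_edges S. g (cell_image \<Phi> e') e')"
proof -
  have "(\<Sum>e'\<in>all_edges S. g (cell_image \<Phi> e') e') =
      (\<Sum>e\<in>K_edges S \<Phi>. \<Sum>e'\<in>edges_over S \<Phi> e. g (cell_image \<Phi> e') e')"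
    unfolding K_edges_def edges_over_def by (rule sum.image_gen) simp
  also have "\<dots> = (\<Sum>e\<in>K_edges S \<Phi>. \<Sum>e'\<in>edges_over S \<Phi> e. g e e')"
    unfolding edges_over_def by (intro sum.cong) auto
  finally show ?thesis by simp
qed

section \<open>The Kang-Rubinstein coordinates\<close>

lemma sum_basis_vec: "finite X \<Longrightarrow> (\<Sum>p\<in>X. basis_vec p D) = of_bool (D \<in> X)"
  unfolding basis_vec_def by simp

lemma W_tet_eq:
  assumes "\<sigma> \<in> S"
  shows "W_tet \<sigma> D = of_bool (D \<in> triangles_in \<sigma>) - of_bool (D \<in> quads_in \<sigma>)"
  unfolding W_tet_def using finite_discs_in[OF assms] by (simp add: sum_basis_vec)

lemma W_edge_eq:
  "W_edge S \<Phi> e D = (\<Sum>e'\<in>edges_over S \<Phi> e. of_bool (D \<in> triangle_types S \<and> e' \<in> disc_edges D) -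
     of_bool (\<exists>\<sigma>\<in>S. e' edge_of \<sigma> \<and> D \<in> quads_in \<sigma> \<and> e' \<notin> disc_edges D))"
proof -
  have "finite {q. \<exists>\<sigma>\<in>S. e' edge_of \<sigma> \<and> q \<in> quads_in \<sigma> \<and> e' \<notin> disc_edges q}" for e'
    by (rule finite_subset[OF _ finite_types(1)]) (auto simp: quad_types_def)
  then show ?thesis
    unfolding W_edge_def by (simp add: sum_basis_vec)
qed

lemma W_comb_eq:
  "W_comb S \<Phi> w z D =
     (\<Sum>\<sigma>\<in>S. w \<sigma> * (of_bool (D \<in> triangles_in \<sigma>) - of_bool (D \<in> quads_in \<sigma>))) +
     (\<Sum>e\<in>all_edges S. z (cell_image \<Phi> e) * (of_bool (D \<in> triangle_types S \<and> e \<in> disc_edges D) -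
       of_bool (\<exists>\<sigma>\<in>S. e edge_of \<sigma> \<and> D \<in> quads_in \<sigma> \<and> e \<notin> disc_edges D)))"
  unfolding W_comb_def W_edge_eq sum_distrib_left sum_K_edges by (simp add: W_tet_eq)

lemma disc_in_unique:
  assumes "D \<in> discs_in \<sigma>"
  shows "D \<in> discs_in \<sigma>' \<longleftrightarrow> \<sigma>' = \<sigma>"
  using assms discs_in_tet by blast

text \<open>
  A triangle type occurs once in the vector of its tetrahedron and once for each of the edges that it meets.
\<close>

lemma W_comb_triangle:
  assumes "\<sigma> \<in> S" "D \<in> triangles_in \<sigma>"
  shows "W_comb S \<Phi> w z D = w \<sigma> + (\<Sum>e\<in>disc_edges D. z (cell_image \<Phi> e))"
proof -
  have D: "D \<in> triangle_types S" "D \<in> discs_in \<sigma>"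
    using assms unfolding triangle_types_def discs_in_def by blast+
  have tri: "D \<in> triangles_in \<sigma>' \<longleftrightarrow> \<sigma>' = \<sigma>" for \<sigma>'
    using disc_in_unique[OF D(2)] assms(2) unfolding discs_in_def by blast
  have quad: "D \<notin> quads_in \<sigma>'" for \<sigma>'
    using assms(2) unfolding triangles_in_def quads_in_def by blast
  have sets: "S \<inter> {\<sigma>} = {\<sigma>}" "all_edges S \<inter> disc_edges D = disc_edges D"
    using assms(1) disc_edges_subset[of D] D(1) by blast+
  show ?thesis
    unfolding W_comb_eq using D(1) by (simp add: tri quad sets)
qed

text \<open>
  A quadrilateral type occurs, with sign, once in the vector of its tetrahedron and once for each of the two
  edges that it faces.
\<close>

lemma W_comb_quad:
  assumes "\<sigma> \<in> S" "D \<in> quads_in \<sigma>"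
  shows "W_comb S \<Phi> w z D = - w \<sigma> - (\<Sum>e\<in>{e. e edge_of \<sigma>} - disc_edges D. z (cell_image \<Phi> e))"
proof -
  have D: "D \<in> quad_types S" "D \<in> discs_in \<sigma>"
    using assms unfolding quad_types_def discs_in_def by blast+
  have quad: "D \<in> quads_in \<sigma>' \<longleftrightarrow> \<sigma>' = \<sigma>" for \<sigma>'
    using disc_in_unique[OF D(2)] assms(2) unfolding discs_in_def by blast
  have tri: "D \<notin> triangles_in \<sigma>'" "D \<notin> triangle_types S" for \<sigma>'
    using assms(2) unfolding triangle_types_def triangles_in_def quads_in_def by blast+
  have sets: "S \<inter> {\<sigma>} = {\<sigma>}"
    "all_edges S \<inter> {e. e edge_of \<sigma> \<and> e \<notin> disc_edges D} = {e. e edge_of \<sigma>} - disc_edges D"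
    using assms(1) unfolding all_edges_def by blast+
  have ex: "(\<exists>\<sigma>'\<in>S. e edge_of \<sigma>' \<and> \<sigma>' = \<sigma> \<and> e \<notin> disc_edges D) \<longleftrightarrow> e edge_of \<sigma> \<and> e \<notin> disc_edges D" for e
    using assms(1) by blast
  show ?thesis
    unfolding W_comb_eq by (simp add: tri quad sets ex sum_negf)
qed

lemma W_comb_other:
  assumes "D \<notin> discs"
  shows "W_comb S \<Phi> w z D = 0"
  using assms unfolding W_comb_eq quad_types_def triangle_types_def
  by (intro add_eq_0_iff[THEN iffD2]) (simp add: sum.neutral)

lemma W_comb_tetrahedron:
  fixes z :: "'a set set \<Rightarrow> real"
  assumes "\<sigma> \<in> S" "tetrahedron a b c d \<sigma>"
  defines "zz \<equiv> \<lambda>x y. z (cell_image \<Phi> (convex hull {x,y}))"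
  shows "W_comb S \<Phi> w z (Triangle \<sigma> a) = w \<sigma> + zz a b + zz a c + zz a d"
    "W_comb S \<Phi> w z (Quad \<sigma> {convex hull {a,b}, convex hull {c,d}}) = - w \<sigma> - zz a b - zz c d"
proof -
  interpret tetrahedron a b c d \<sigma> by fact
  have mem: "Triangle \<sigma> a \<in> triangles_in \<sigma>" "Quad \<sigma> {edge a b, edge c d} \<in> quads_in \<sigma>"
    unfolding triangles quads by simp_all
  show "W_comb S \<Phi> w z (Triangle \<sigma> a) = w \<sigma> + zz a b + zz a c + zz a d"
    unfolding W_comb_triangle[OF assms(1) mem(1)] disc_edges_Triangle zz_def
    by (simp add: doubleton_eq_iff)
  have "{edge a b, edge a c, edge a d, edge b c, edge b d, edge c d} -
      {edge a c, edge a d, edge b c, edge b d} = {edge a b, edge c d}"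
    by (auto simp: doubleton_eq_iff)
  then show "W_comb S \<Phi> w z (Quad \<sigma> {convex hull {a,b}, convex hull {c,d}}) = - w \<sigma> - zz a b - zz c d"
    unfolding W_comb_quad[OF assms(1) mem(2)] disc_edges_Quad edges zz_def
    by (simp add: doubleton_eq_iff)
qed

lemma W_comb_tetrahedron_all:
  fixes z :: "'a set set \<Rightarrow> real"
  assumes "\<sigma> \<in> S" "tetrahedron a b c d \<sigma>"
  defines "zz \<equiv> \<lambda>x y. z (cell_image \<Phi> (convex hull {x,y}))"
  shows "W_comb S \<Phi> w z (Triangle \<sigma> a) = w \<sigma> + zz a b + zz a c + zz a d"
    "W_comb S \<Phi> w z (Triangle \<sigma> b) = w \<sigma> + zz a b + zz b c + zz b d"
    "W_comb S \<Phi> w z (Triangle \<sigma> c) = w \<sigma> + zz a c + zz b c + zz c d"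
    "W_comb S \<Phi> w z (Triangle \<sigma> d) = w \<sigma> + zz a d + zz b d + zz c d"
    "W_comb S \<Phi> w z (Quad \<sigma> {convex hull {a,b}, convex hull {c,d}}) = - w \<sigma> - zz a b - zz c d"
    "W_comb S \<Phi> w z (Quad \<sigma> {convex hull {a,c}, convex hull {b,d}}) = - w \<sigma> - zz a c - zz b d"
    "W_comb S \<Phi> w z (Quad \<sigma> {convex hull {a,d}, convex hull {b,c}}) = - w \<sigma> - zz a d - zz b c"
  using W_comb_tetrahedron[OF assms(1,2), of w z]
    W_comb_tetrahedron[OF assms(1) tetrahedron_relabelings(1)[OF assms(2)], of w z]
    W_comb_tetrahedron[OF assms(1) tetrahedron_relabelings(2)[OF assms(2)], of w z]
    W_comb_tetrahedron[OF assms(1) tetrahedron_relabelings(3)[OF assms(2)], of w z]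
    W_comb_tetrahedron[OF assms(1) tetrahedron_relabelings(4)[OF assms(2)], of w z]
    W_comb_tetrahedron[OF assms(1) tetrahedron_relabelings(5)[OF assms(2)], of w z]
  unfolding zz_def by (simp_all add: insert_commute)

text \<open>
  The coefficient \<open>w\<close> cancels, since two triangles and two quadrilaterals meet the edge; so do the
  coefficients of the four edges adjacent to it, while its own coefficient appears in both triangles.
\<close>

lemma edge_weight_W_comb:
  assumes "e \<in> all_edges S"
  shows "edge_weight (W_comb S \<Phi> w z) e = 2 * z (cell_image \<Phi> e)"
proof -
  obtain \<sigma> where \<sigma>: "\<sigma> \<in> S" "e edge_of \<sigma>" using assms unfolding all_edges_def by blast
  obtain a b c d where t: "tetrahedron a b c d \<sigma>" and e: "e = convex hull {a,b}"
    using tetrahedron_edge[OF simplex_S[OF \<sigma>(1)] \<sigma>(2)] by blast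
  show ?thesis
    unfolding e edge_weight_tetrahedron[OF \<sigma>(1) t] W_comb_tetrahedron_all[OF \<sigma>(1) t] by simp
qed

lemma edge_weights_tetrahedron:
  assumes "\<sigma> \<in> S" "tetrahedron a b c d \<sigma>"
  defines "Q1 \<equiv> Quad \<sigma> {convex hull {a,b}, convex hull {c,d}}"
    and "Q2 \<equiv> Quad \<sigma> {convex hull {a,c}, convex hull {b,d}}"
    and "Q3 \<equiv> Quad \<sigma> {convex hull {a,d}, convex hull {b,c}}"
  shows "edge_weight s (convex hull {a,b}) = s (Triangle \<sigma> a) + s (Triangle \<sigma> b) + s Q2 + s Q3"
    "edge_weight s (convex hull {a,c}) = s (Triangle \<sigma> a) + s (Triangle \<sigma> c) + s Q1 + s Q3"
    "edge_weight s (convex hull {a,d}) = s (Triangle \<sigma> a) + s (Triangle \<sigma> d) + s Q1 + s Q2"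
    "edge_weight s (convex hull {b,c}) = s (Triangle \<sigma> b) + s (Triangle \<sigma> c) + s Q1 + s Q2"
    "edge_weight s (convex hull {b,d}) = s (Triangle \<sigma> b) + s (Triangle \<sigma> d) + s Q1 + s Q3"
    "edge_weight s (convex hull {c,d}) = s (Triangle \<sigma> c) + s (Triangle \<sigma> d) + s Q2 + s Q3"
  unfolding Q1_def Q2_def Q3_def
  using edge_weight_tetrahedron[OF assms(1,2), of s]
    edge_weight_tetrahedron[OF assms(1) tetrahedron_relabelings(4)[OF assms(2)], of s]
    edge_weight_tetrahedron[OF assms(1) tetrahedron_relabelings(5)[OF assms(2)], of s]
    edge_weight_tetrahedron[OF assms(1) tetrahedron_relabelings(6)[OF assms(2)], of s]
    edge_weight_tetrahedron[OF assms(1) tetrahedron_relabelings(7)[OF assms(2)], of s]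
    edge_weight_tetrahedron[OF assms(1) tetrahedron_relabelings(8)[OF assms(2)], of s]
  by (simp_all add: insert_commute)

text \<open>
  Adding the formulas for the seven values of a combination in one tetrahedron, with the
  quadrilaterals counted twice, gives \<open>-2w\<close>; this is where the coefficient of the tetrahedron comes from.
  With it, the six weights fix the seven values by linear algebra.
\<close>

lemma eq_W_comb_of_edge_weights:
  assumes zero: "\<And>D. D \<notin> discs \<Longrightarrow> s D = 0"
    and weight: "\<And>e. e \<in> all_edges S \<Longrightarrow> edge_weight s e = 2 * z (cell_image \<Phi> e)"
  shows "s = W_comb S \<Phi> (\<lambda>\<sigma>. - (\<Sum>p\<in>triangles_in \<sigma>. s p) / 2 - (\<Sum>q\<in>quads_in \<sigma>. s q)) z"
    (is "s = W_comb S \<Phi> ?w z")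
proof
  fix D
  show "s D = W_comb S \<Phi> ?w z D"
  proof (cases "D \<in> discs")
    case True
    then obtain \<sigma> where \<sigma>: "\<sigma> \<in> S" and D: "D \<in> discs_in \<sigma>" unfolding discs_eq by blast
    obtain a b c d where t: "tetrahedron a b c d \<sigma>"
      using tetrahedron_exists[OF simplex_S[OF \<sigma>]] by blast
    interpret tetrahedron a b c d \<sigma> by fact
    have "e \<in> all_edges S" if "e \<in> {edge a b, edge a c, edge a d, edge b c, edge b d, edge c d}" for e
      using that \<sigma> edge_of_iff unfolding all_edges_def by blast
    then have z: "z (cell_image \<Phi> e) = edge_weight s e / 2"
      if "e \<in> {edge a b, edge a c, edge a d, edge b c, edge b d, edge c d}" for e
      using weight that by simp
    have w: "?w \<sigma> = - (s (Triangle \<sigma> a) + s (Triangle \<sigma> b) + s (Triangle \<sigma> c) + s (Triangle \<sigma> d)) / 2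
      - (s (Quad \<sigma> {edge a b, edge c d}) + s (Quad \<sigma> {edge a c, edge b d}) + s (Quad \<sigma> {edge a d, edge b c}))"
      unfolding triangles quads by (simp add: doubleton_eq_iff)
    show ?thesis
      using D unfolding discs_in_def quads triangles Un_iff
      by (elim disjE insertE emptyE)
         (simp_all only: W_comb_tetrahedron_all[OF \<sigma> t] w,
          simp_all only: z insert_iff simp_thms edge_weights_tetrahedron[OF \<sigma> t], argo+)
  next
    case False
    then show ?thesis using zero W_comb_other by simp
  qed
qed

text \<open>
  The matching equation at the arc around a vertex of the face equates one quadrilateral and one triangle
  coordinate. The four types that meet an edge of the face are the two such pairs at the ends of the edge.
\<close>

lemma edge_weight_glued_face:
  assumes "(\<tau>, \<delta>, \<phi>) \<in> \<Phi>" "s \<in> solution_space S \<Phi>" "e edge_of \<tau>"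
  shows "edge_weight s e = edge_weight s (\<phi> ` e)"
proof (rule pairing_tetrahedra[OF assms(1)])
  fix \<sigma> \<sigma>' a b c d d'
  assume \<sigma>: "\<sigma> \<in> S" "\<sigma>' \<in> S"
    and t: "tetrahedron a b c d \<sigma>" and \<tau>: "\<tau> = convex hull {a,b,c}" "\<tau> facet_of \<sigma>"
    and t': "tetrahedron (\<phi> a) (\<phi> b) (\<phi> c) d' \<sigma>'"
    and \<delta>: "\<delta> = convex hull {\<phi> a, \<phi> b, \<phi> c}" "\<delta> facet_of \<sigma>'"
    and im: "\<phi> ` (convex hull {a,b}) = convex hull {\<phi> a, \<phi> b}"
    "\<phi> ` (convex hull {a,c}) = convex hull {\<phi> a, \<phi> c}"
    "\<phi> ` (convex hull {b,c}) = convex hull {\<phi> b, \<phi> c}"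
  interpret t: tetrahedron a b c d \<sigma> by fact
  interpret t': tetrahedron "\<phi> a" "\<phi> b" "\<phi> c" d' \<sigma>' by fact
  have match: "s q + s p = s q' + s p'"
    if "q \<in> quads_in \<sigma>" "p \<in> triangles_in \<sigma>" "q' \<in> quads_in \<sigma>'" "p' \<in> triangles_in \<sigma>'"
      "meets_in_arc q \<tau> A" "meets_in_arc p \<tau> A"
      "meets_in_arc q' \<delta> ((`) \<phi> ` A)" "meets_in_arc p' \<delta> ((`) \<phi> ` A)" for q p q' p' A
  proof -
    have "A \<in> arc_types \<tau>" using that(5) unfolding meets_in_arc_def by blast
    then show ?thesis
      using assms(1,2) \<sigma> \<tau>(2) \<delta>(2) that unfolding solution_space_def by blast
  qed
  have arc_a: "s (Quad \<sigma> {t.edge a d, t.edge b c}) + s (Triangle \<sigma> a)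
      = s (Quad \<sigma>' {t.edge (\<phi> a) d', t.edge (\<phi> b) (\<phi> c)}) + s (Triangle \<sigma>' (\<phi> a))"
    by (rule match[where A = "{t.edge a b, t.edge a c}"])
      (auto simp: meets_in_arc_def arc_types_def t.quads t.triangles t'.quads t'.triangles
        t.disc_edges_simps t'.disc_edges_simps \<tau>(1) \<delta>(1) t.edges_abc t'.edges_abc im doubleton_eq_iff
        simp del: disc_edges.simps)
  have arc_b: "s (Quad \<sigma> {t.edge a c, t.edge b d}) + s (Triangle \<sigma> b)
      = s (Quad \<sigma>' {t.edge (\<phi> a) (\<phi> c), t.edge (\<phi> b) d'}) + s (Triangle \<sigma>' (\<phi> b))"
    by (rule match[where A = "{t.edge a b, t.edge b c}"])
      (auto simp: meets_in_arc_def arc_types_def t.quads t.triangles t'.quads t'.triangles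
        t.disc_edges_simps t'.disc_edges_simps \<tau>(1) \<delta>(1) t.edges_abc t'.edges_abc im doubleton_eq_iff
        simp del: disc_edges.simps)
  have arc_c: "s (Quad \<sigma> {t.edge a b, t.edge c d}) + s (Triangle \<sigma> c)
      = s (Quad \<sigma>' {t.edge (\<phi> a) (\<phi> b), t.edge (\<phi> c) d'}) + s (Triangle \<sigma>' (\<phi> c))"
    by (rule match[where A = "{t.edge a c, t.edge b c}"])
      (auto simp: meets_in_arc_def arc_types_def t.quads t.triangles t'.quads t'.triangles
        t.disc_edges_simps t'.disc_edges_simps \<tau>(1) \<delta>(1) t.edges_abc t'.edges_abc im doubleton_eq_iff
        simp del: disc_edges.simps)
  have "e \<in> {e. e edge_of \<tau>}" using assms(3) by simp
  then show ?thesis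
    unfolding \<tau>(1) t.edges_abc
    by (elim insertE emptyE; simp only: im edge_weights_tetrahedron[OF \<sigma>(1) t] edge_weights_tetrahedron[OF \<sigma>(2) t'])
       (use arc_a arc_b arc_c in linarith)+
qed

lemma edge_weight_cell_image:
  assumes "s \<in> solution_space S \<Phi>" "e \<in> all_edges S" "e' \<in> all_edges S"
    and "cell_image \<Phi> e = cell_image \<Phi> e'"
  shows "edge_weight s e = edge_weight s e'"
proof -
  have step: "edge_weight s x = edge_weight s y" if "glue_edges \<Phi> x y" for x y
    using that edge_weight_glued_face[OF _ assms(1)] unfolding glue_edges_def by blast
  from cell_image_eq_imp_equiv[OF assms(2-4)] show ?thesis
    by (induction rule: equivclp_induct) (auto dest: step)
qed

lemma solution_space_W_comb:
  assumes "s \<in> solution_space S \<Phi>"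
  shows "\<exists>w z. s = W_comb S \<Phi> w z"
proof -
  \<comment> \<open>The choice of the edge over \<open>E\<close> does not matter, since the weight is constant on each class.\<close>
  define z where "z E = edge_weight s (SOME e. e \<in> edges_over S \<Phi> E) / 2" for E
  have "edge_weight s e = 2 * z (cell_image \<Phi> e)" if e: "e \<in> all_edges S" for e
  proof -
    have "e \<in> edges_over S \<Phi> (cell_image \<Phi> e)" using e unfolding edges_over_def by simp
    then have "(SOME e'. e' \<in> edges_over S \<Phi> (cell_image \<Phi> e)) \<in> edges_over S \<Phi> (cell_image \<Phi> e)"
      by (rule someI)
    then show ?thesis
      using edge_weight_cell_image[OF assms _ e] unfolding z_def edges_over_def by simp
  qed
  moreover have "s D = 0" if "D \<notin> discs" for D
    using assms that unfolding solution_space_def by blast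
  ultimately show ?thesis using eq_W_comb_of_edge_weights by blast
qed

text \<open>
  The coefficients \<open>z\<close> are half the edge weights of \<open>s\<close>, so every expansion of \<open>s\<close> gives the same value.
\<close>

lemma chi_area_curvature_W_comb:
  assumes "s = W_comb S \<Phi> w z"
  shows "chi_area_curvature S \<Phi> A \<kappa> s =
    1 / (2 * pi) * ((\<Sum>p\<in>triangle_types S. s p * A p) + (\<Sum>e\<in>K_edges S \<Phi>. 2 * z e * \<kappa> e))"
  unfolding chi_area_curvature_def
proof (rule the_equality)
  fix r assume "\<exists>w' z'. s = W_comb S \<Phi> w' z' \<and>
    r = 1 / (2 * pi) * ((\<Sum>p\<in>triangle_types S. s p * A p) + (\<Sum>e\<in>K_edges S \<Phi>. 2 * z' e * \<kappa> e))"
  then obtain w' z' where s: "s = W_comb S \<Phi> w' z'" and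
    r: "r = 1 / (2 * pi) * ((\<Sum>p\<in>triangle_types S. s p * A p) + (\<Sum>e\<in>K_edges S \<Phi>. 2 * z' e * \<kappa> e))"
    by blast
  have "z' e = z e" if e: "e \<in> K_edges S \<Phi>" for e
  proof -
    obtain e' where "e' \<in> all_edges S" "e = cell_image \<Phi> e'" using e unfolding K_edges_def by blast
    then show ?thesis
      using edge_weight_W_comb[of e' w z] edge_weight_W_comb[of e' w' z'] assms s by simp
  qed
  then show "r = 1 / (2 * pi) * ((\<Sum>p\<in>triangle_types S. s p * A p) + (\<Sum>e\<in>K_edges S \<Phi>. 2 * z e * \<kappa> e))"
    unfolding r by simp
qed (use assms in blast)

section \<open>The Gauss-Bonnet formula\<close>

definition boundary_faces_at :: "'a set \<Rightarrow> nat" where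
  "boundary_faces_at e = card {\<tau> \<in> unpaired_faces S \<Phi>. e edge_of \<tau>}"

text \<open>
  Each arc in an unpaired face has two corners, on edges of that face.
\<close>

lemma boundary_arcs_eq:
  assumes "D \<in> discs"
  shows "2 * boundary_arcs S \<Phi> D = (\<Sum>e\<in>disc_edges D. boundary_faces_at e)"
proof -
  obtain \<sigma> where \<sigma>: "\<sigma> \<in> S" and D: "D \<in> discs_in \<sigma>" using assms unfolding discs_eq by blast
  have card: "card {e \<in> disc_edges D. e edge_of \<tau>} =
      2 * of_bool (\<tau> facet_of \<sigma> \<and> (\<exists>a. meets_in_arc D \<tau> a))" if \<tau>: "\<tau> \<in> unpaired_faces S \<Phi>" for \<tau>
  proof (cases "\<tau> facet_of \<sigma>")
    case True
    have "{e \<in> disc_edges D. e edge_of \<tau>} = disc_edges D \<inter> {e. e edge_of \<tau>}" by blast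
    then show ?thesis
      using card_disc_edges_facet[OF simplex_S[OF \<sigma>] True D] True by simp
  next
    case False
    obtain \<sigma>' where \<sigma>': "\<sigma>' \<in> S" "\<tau> facet_of \<sigma>'"
      using \<tau> unfolding unpaired_faces_def all_faces_def by blast
    have "\<not> e edge_of \<tau>" if "e \<in> disc_edges D" for e
      using same_tetrahedron_edge[OF \<sigma> \<sigma>'(1) disc_edges_in[OF D that]]
        edge_of_facet_trans[OF \<sigma>'(2)] \<sigma>'(2) False by blast
    then have "{e \<in> disc_edges D. e edge_of \<tau>} = {}" by blast
    then have "card {e \<in> disc_edges D. e edge_of \<tau>} = 0" by (simp only: card.empty)
    then show ?thesis using False by simp
  qed
  have fin: "finite (disc_edges D)"
    using disc_edges_subset[OF assms] finite_all_edges by (rule finite_subset)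
  have "(\<Sum>e\<in>disc_edges D. boundary_faces_at e) =
      (\<Sum>\<tau>\<in>unpaired_faces S \<Phi>. card {e \<in> disc_edges D. e edge_of \<tau>})"
    unfolding boundary_faces_at_def card_eq_sum
    using fin by (intro sum.swap_restrict) simp_all
  also have "\<dots> = (\<Sum>\<tau>\<in>unpaired_faces S \<Phi>. 2 * of_bool (\<tau> facet_of \<sigma> \<and> (\<exists>a. meets_in_arc D \<tau> a)))"
    by (intro sum.cong refl card)
  also have "\<dots> = 2 * card (unpaired_faces S \<Phi> \<inter> {\<tau>. \<tau> facet_of \<sigma> \<and> (\<exists>a. meets_in_arc D \<tau> a)})"
    by (simp only: sum_distrib_left[symmetric] sum_of_bool_eq finite_unpaired_faces of_nat_id)
  also have "unpaired_faces S \<Phi> \<inter> {\<tau>. \<tau> facet_of \<sigma> \<and> (\<exists>a. meets_in_arc D \<tau> a)} =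
      {\<tau>. \<tau> facet_of disc_tet D \<and> \<tau> \<in> unpaired_faces S \<Phi> \<and> (\<exists>a. meets_in_arc D \<tau> a)}"
    unfolding discs_in_tet[OF D] by blast
  finally show ?thesis unfolding boundary_arcs_def by simp
qed

lemma sum_boundary_faces_at:
  assumes "e \<in> K_edges S \<Phi>"
  shows "(\<Sum>e'\<in>edges_over S \<Phi> e. boundary_faces_at e') = (if e \<subseteq> K_boundary S \<Phi> then 2 else 0)"
proof -
  have "(\<Sum>e'\<in>edges_over S \<Phi> e. boundary_faces_at e') =
      card (SIGMA e':edges_over S \<Phi> e. {\<tau> \<in> unpaired_faces S \<Phi>. e' edge_of \<tau>})"
    unfolding boundary_faces_at_def by simp
  also have "(SIGMA e':edges_over S \<Phi> e. {\<tau> \<in> unpaired_faces S \<Phi>. e' edge_of \<tau>}) =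
      {(e', \<tau>). e' \<in> edges_over S \<Phi> e \<and> \<tau> \<in> unpaired_faces S \<Phi> \<and> e' edge_of \<tau>}"
    by blast
  finally show ?thesis using card_boundary_flags[OF assms] by simp
qed

lemma edge_degree_pos:
  assumes "e \<in> K_edges S \<Phi>"
  shows "edge_degree S \<Phi> e > 0"
proof -
  have "edges_over S \<Phi> e \<noteq> {}" using assms unfolding K_edges_def edges_over_def by blast
  then show ?thesis unfolding edge_degree_def by (simp add: card_gt_0_iff)
qed

lemma sum_discs_split: "(\<Sum>D\<in>discs. f D) = (\<Sum>q\<in>quad_types S. f q) + (\<Sum>p\<in>triangle_types S. f p)"
  using types_disjoint by (intro sum.union_disjoint) simp_all

text \<open>
  The term \<open>1/d(e)\<close> at each of the \<open>d(e)\<close> tetrahedron edges over \<open>e\<close> adds up to the weight \<open>2 z e\<close>. Each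
  boundary arc costs a half, a quarter for each of its corners; since a boundary edge carries
  two unpaired faces, this removes \<open>z e\<close> there.
\<close>

lemma chi_star_eq:
  assumes weight: "\<And>e. e \<in> all_edges S \<Longrightarrow> edge_weight s e = 2 * z (cell_image \<Phi> e)"
  shows "chi_star S \<Phi> s = (\<Sum>e\<in>K_edges S \<Phi>. (if e \<subseteq> K_boundary S \<Phi> then 1 else 2) * z e)
    - (\<Sum>p\<in>triangle_types S. s p) / 2 - (\<Sum>q\<in>quad_types S. s q)"
proof -
  \<comment> \<open>What one corner at \<open>e\<close> contributes to \<open>chi_star\<close>: a boundary arc costs 1/2, hence 1/4 for each endpoint.\<close>
  define d where "d e = 1 / real (edge_degree S \<Phi> (cell_image \<Phi> e)) - real (boundary_faces_at e) / 4" for e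
  have bd: "(\<Sum>e\<in>disc_edges D. real (boundary_faces_at e) / 4) = real (boundary_arcs S \<Phi> D) / 2"
    if "D \<in> discs" for D
  proof -
    have "2 * real (boundary_arcs S \<Phi> D) = (\<Sum>e\<in>disc_edges D. real (boundary_faces_at e))"
      using boundary_arcs_eq[OF that, THEN arg_cong, of real] by simp
    then show ?thesis unfolding sum_divide_distrib[symmetric] by simp
  qed
  have d: "(\<Sum>e\<in>disc_edges D. d e) =
      (\<Sum>e\<in>disc_edges D. 1 / real (edge_degree S \<Phi> (cell_image \<Phi> e))) - real (boundary_arcs S \<Phi> D) / 2"
    if "D \<in> discs" for D
    unfolding d_def sum_subtractf bd[OF that] ..
  have tri: "chi_star_disc S \<Phi> D = - 1/2 + (\<Sum>e\<in>disc_edges D. d e)" if D: "D \<in> triangle_types S" for D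
  proof -
    obtain \<sigma> v where eq: "D = Triangle \<sigma> v"
      using D unfolding triangle_types_def triangles_in_def by blast
    show ?thesis
      unfolding d[OF UnI2[OF D]] unfolding eq chi_star_disc.simps by argo
  qed
  have quad: "chi_star_disc S \<Phi> D = - 1 + (\<Sum>e\<in>disc_edges D. d e)" if D: "D \<in> quad_types S" for D
  proof -
    obtain \<sigma> Q where eq: "D = Quad \<sigma> Q"
      using D unfolding quad_types_def quads_in_def by blast
    show ?thesis
      unfolding d[OF UnI1[OF D]] unfolding eq chi_star_disc.simps by argo
  qed
  have "chi_star S \<Phi> s = (\<Sum>D\<in>discs. s D * (\<Sum>e\<in>disc_edges D. d e))
      - (\<Sum>p\<in>triangle_types S. s p) / 2 - (\<Sum>q\<in>quad_types S. s q)"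
    unfolding chi_star_def sum_discs_split
    by (simp add: tri quad algebra_simps sum.distrib sum_subtractf sum_divide_distrib sum_negf)
  also have "(\<Sum>D\<in>discs. s D * (\<Sum>e\<in>disc_edges D. d e)) = (\<Sum>e\<in>all_edges S. d e * edge_weight s e)"
    by (rule sum_discs_edges)
  also have "\<dots> = (\<Sum>e\<in>all_edges S. 2 * z (cell_image \<Phi> e) / real (edge_degree S \<Phi> (cell_image \<Phi> e))
      - z (cell_image \<Phi> e) / 2 * real (boundary_faces_at e))"
    by (intro sum.cong refl) (simp add: weight d_def algebra_simps)
  also have "\<dots> = (\<Sum>e\<in>K_edges S \<Phi>. \<Sum>e'\<in>edges_over S \<Phi> e. 2 * z e / real (edge_degree S \<Phi> e)
      - z e / 2 * real (boundary_faces_at e'))"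
    by (rule sum_K_edges[symmetric])
  also have "\<dots> = (\<Sum>e\<in>K_edges S \<Phi>. (if e \<subseteq> K_boundary S \<Phi> then 1 else 2) * z e)"
  proof (rule sum.cong[OF refl])
    fix e assume e: "e \<in> K_edges S \<Phi>"
    have degree: "(\<Sum>e'\<in>edges_over S \<Phi> e. 2 * z e / real (edge_degree S \<Phi> e)) = 2 * z e"
      using edge_degree_pos[OF e] by (auto simp: edge_degree_def card_gt_0_iff)
    have faces: "(\<Sum>e'\<in>edges_over S \<Phi> e. z e / 2 * real (boundary_faces_at e')) =
        z e / 2 * real (\<Sum>e'\<in>edges_over S \<Phi> e. boundary_faces_at e')"
      by (simp only: sum_distrib_left of_nat_sum)
    show "(\<Sum>e'\<in>edges_over S \<Phi> e. 2 * z e / real (edge_degree S \<Phi> e)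
        - z e / 2 * real (boundary_faces_at e')) = (if e \<subseteq> K_boundary S \<Phi> then 1 else 2) * z e"
      unfolding sum_subtractf degree faces sum_boundary_faces_at[OF e] by simp
  qed
  finally show ?thesis .
qed

text \<open>
  The angle sum over all corners, weighted by \<open>s\<close>, is evaluated in two ways. Edge by edge, the definition of
  curvature replaces it by \<open>2\<pi>\<close> or \<open>\<pi>\<close> per unit of \<open>2 z e\<close>, minus the curvature term; disc by disc, the
  definition of area replaces the triangle part by \<open>A + \<pi>\<close>. The multiples of \<open>\<pi>\<close> that remain add up to the
  generalised Euler characteristic, up to \<open>2\<pi>\<close> per quadrilateral.
\<close>

lemma Gauss_Bonnet:
  assumes "has_area_curvature S \<Phi> A \<kappa> \<alpha>" "s \<in> solution_space S \<Phi>"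
  shows "2 * pi * (chi_star S \<Phi> s - chi_area_curvature S \<Phi> A \<kappa> s) =
    (\<Sum>q\<in>quad_types S. s q * ((\<Sum>e\<in>disc_edges q. \<alpha> e) - 2 * pi))"
proof -
  obtain w z where s: "s = W_comb S \<Phi> w z" using solution_space_W_comb[OF assms(2)] by blast
  have weight: "edge_weight s e = 2 * z (cell_image \<Phi> e)" if "e \<in> all_edges S" for e
    using edge_weight_W_comb[OF that] s by simp
  define B where "B = (\<Sum>e\<in>K_edges S \<Phi>. (if e \<subseteq> K_boundary S \<Phi> then 1 else 2) * z e)"
  have "(\<Sum>e\<in>K_edges S \<Phi>. 2 * z e * \<kappa> e) =
      (\<Sum>e\<in>K_edges S \<Phi>. 2 * pi * ((if e \<subseteq> K_boundary S \<Phi> then 1 else 2) * z e)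
        - (\<Sum>e'\<in>edges_over S \<Phi> e. \<alpha> e' * (2 * z e)))"
  proof (rule sum.cong[OF refl])
    fix e assume "e \<in> K_edges S \<Phi>"
    then have \<kappa>: "\<kappa> e = curvature S \<Phi> \<alpha> e" using assms(1) unfolding has_area_curvature_def by simp
    show "2 * z e * \<kappa> e = 2 * pi * ((if e \<subseteq> K_boundary S \<Phi> then 1 else 2) * z e)
        - (\<Sum>e'\<in>edges_over S \<Phi> e. \<alpha> e' * (2 * z e))"
      unfolding \<kappa> curvature_def sum_distrib_right[symmetric] by (simp add: algebra_simps)
  qed
  also have "\<dots> = 2 * pi * B - (\<Sum>e\<in>all_edges S. \<alpha> e * (2 * z (cell_image \<Phi> e)))"
    unfolding sum_subtractf B_def sum_distrib_left sum_K_edges ..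
  also have "(\<Sum>e\<in>all_edges S. \<alpha> e * (2 * z (cell_image \<Phi> e))) = (\<Sum>e\<in>all_edges S. \<alpha> e * edge_weight s e)"
    by (intro sum.cong refl) (simp add: weight)
  also have "\<dots> = (\<Sum>q\<in>quad_types S. s q * (\<Sum>e\<in>disc_edges q. \<alpha> e))
      + (\<Sum>p\<in>triangle_types S. s p * (\<Sum>e\<in>disc_edges p. \<alpha> e))"
    unfolding sum_discs_edges[symmetric] sum_discs_split ..
  also have "(\<Sum>p\<in>triangle_types S. s p * (\<Sum>e\<in>disc_edges p. \<alpha> e)) =
      (\<Sum>p\<in>triangle_types S. s p * A p + pi * s p)"
    using assms(1) unfolding has_area_curvature_def area_def
    by (intro sum.cong refl) (auto simp: algebra_simps)
  finally have \<kappa>: "(\<Sum>e\<in>K_edges S \<Phi>. 2 * z e * \<kappa> e) = 2 * pi * B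
      - (\<Sum>q\<in>quad_types S. s q * (\<Sum>e\<in>disc_edges q. \<alpha> e))
      - (\<Sum>p\<in>triangle_types S. s p * A p) - pi * (\<Sum>p\<in>triangle_types S. s p)"
    by (simp add: sum.distrib sum_distrib_left)
  have "2 * pi * chi_area_curvature S \<Phi> A \<kappa> s = (\<Sum>p\<in>triangle_types S. s p * A p)
      + (\<Sum>e\<in>K_edges S \<Phi>. 2 * z e * \<kappa> e)"
    unfolding chi_area_curvature_W_comb[OF s] by simp
  moreover have "2 * pi * chi_star S \<Phi> s = 2 * pi * B - pi * (\<Sum>p\<in>triangle_types S. s p)
      - 2 * pi * (\<Sum>q\<in>quad_types S. s q)"
  proof -
    have chi: "chi_star S \<Phi> s = B - (\<Sum>p\<in>triangle_types S. s p) / 2 - (\<Sum>q\<in>quad_types S. s q)"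
      unfolding B_def by (rule chi_star_eq[OF weight])
    show ?thesis unfolding chi by (simp add: algebra_simps)
  qed
  ultimately show ?thesis
    unfolding \<kappa> by (simp add: algebra_simps sum_subtractf sum_distrib_left)
qed

text \<open>
  Half the sum of the four triangle areas is the sum of all six angles minus \<open>2\<pi>\<close>, and the corners of \<open>q\<close> lie
  at all edges but the two that \<open>q\<close> faces.
\<close>

lemma sum_angles_quad:
  assumes "q \<in> quad_types S" and area: "\<And>p. p \<in> triangle_types S \<Longrightarrow> area \<alpha> p \<le> 0"
  obtains e e' where "e \<in> all_edges S" "e' \<in> all_edges S"
    "(\<Sum>e\<in>disc_edges q. \<alpha> e) \<le> 2 * pi - \<alpha> e - \<alpha> e'"
proof -
  obtain \<sigma> where \<sigma>: "\<sigma> \<in> S" "q \<in> quads_in \<sigma>" using assms(1) unfolding quad_types_def by blast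
  obtain a b c d where t0: "tetrahedron a b c d \<sigma>"
    using tetrahedron_exists[OF simplex_S[OF \<sigma>(1)]] by blast
  have "\<exists>a b c d. tetrahedron a b c d \<sigma> \<and> q = Quad \<sigma> {convex hull {a,b}, convex hull {c,d}}"
    using \<sigma>(2) unfolding tetrahedron.quads[OF t0]
    by (elim insertE emptyE) (use t0 tetrahedron_relabelings(4,5)[OF t0] in blast)+
  then obtain a b c d where t: "tetrahedron a b c d \<sigma>"
    and q: "q = Quad \<sigma> {convex hull {a,b}, convex hull {c,d}}"
    by blast
  interpret tetrahedron a b c d \<sigma> by fact
  show thesis
  proof (rule that)
    show "edge a b \<in> all_edges S" "edge c d \<in> all_edges S"
      using \<sigma>(1) edge_of_iff unfolding all_edges_def by blast+
    have "area \<alpha> p \<le> 0" if "p \<in> {Triangle \<sigma> a, Triangle \<sigma> b, Triangle \<sigma> c, Triangle \<sigma> d}" for p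
      using that area \<sigma>(1) triangles unfolding triangle_types_def by blast
    then have "area \<alpha> (Triangle \<sigma> a) \<le> 0" "area \<alpha> (Triangle \<sigma> b) \<le> 0"
      "area \<alpha> (Triangle \<sigma> c) \<le> 0" "area \<alpha> (Triangle \<sigma> d) \<le> 0" by simp_all
    then show "(\<Sum>e\<in>disc_edges q. \<alpha> e) \<le> 2 * pi - \<alpha> (edge a b) - \<alpha> (edge c d)"
      unfolding area_def q disc_edges_simps by (simp add: doubleton_eq_iff)
  qed
qed

lemma chi_star_le_chi_area_curvature:
  assumes "semi_angle_structure S \<Phi> A \<kappa> \<alpha>" "\<forall>p\<in>triangle_types S. A p \<le> 0"
    and "s \<in> solution_space S \<Phi>" "\<forall>q\<in>quad_types S. s q \<ge> 0"
  shows "chi_star S \<Phi> s \<le> chi_area_curvature S \<Phi> A \<kappa> s"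
proof -
  have ac: "has_area_curvature S \<Phi> A \<kappa> \<alpha>" and pos: "\<And>e. e \<in> all_edges S \<Longrightarrow> \<alpha> e \<ge> 0"
    using assms(1) unfolding semi_angle_structure_def by blast+
  have area: "area \<alpha> p \<le> 0" if "p \<in> triangle_types S" for p
    using ac assms(2) that unfolding has_area_curvature_def by simp
  have "(\<Sum>e\<in>disc_edges q. \<alpha> e) - 2 * pi \<le> 0" if q: "q \<in> quad_types S" for q
  proof -
    obtain e e' where e: "e \<in> all_edges S" "e' \<in> all_edges S"
      and "(\<Sum>e\<in>disc_edges q. \<alpha> e) \<le> 2 * pi - \<alpha> e - \<alpha> e'"
      using sum_angles_quad[OF q area] .
    then show ?thesis using pos[OF e(1)] pos[OF e(2)] by linarith
  qed
  then have "(\<Sum>q\<in>quad_types S. s q * ((\<Sum>e\<in>disc_edges q. \<alpha> e) - 2 * pi)) \<le> 0"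
    using assms(4) by (intro sum_nonpos) (simp add: mult_nonneg_nonpos)
  then have "2 * pi * (chi_star S \<Phi> s - chi_area_curvature S \<Phi> A \<kappa> s) \<le> 0"
    unfolding Gauss_Bonnet[OF ac assms(3)] .
  then show ?thesis by (auto simp: mult_le_0_iff dest: order.strict_trans2[OF pi_gt_zero])
qed

lemma chi_star_less_chi_area_curvature:
  assumes "angle_structure S \<Phi> A \<kappa> \<alpha>" "\<forall>p\<in>triangle_types S. A p \<le> 0"
    and "s \<in> solution_space S \<Phi>" "\<forall>q\<in>quad_types S. s q \<ge> 0" "\<exists>q\<in>quad_types S. s q > 0"
  shows "chi_star S \<Phi> s < chi_area_curvature S \<Phi> A \<kappa> s"
proof -
  have ac: "has_area_curvature S \<Phi> A \<kappa> \<alpha>" and pos: "\<And>e. e \<in> all_edges S \<Longrightarrow> \<alpha> e > 0"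
    using assms(1) unfolding angle_structure_def by blast+
  have area: "area \<alpha> p \<le> 0" if "p \<in> triangle_types S" for p
    using ac assms(2) that unfolding has_area_curvature_def by simp
  have neg: "(\<Sum>e\<in>disc_edges q. \<alpha> e) - 2 * pi < 0" if q: "q \<in> quad_types S" for q
  proof -
    obtain e e' where e: "e \<in> all_edges S" "e' \<in> all_edges S"
      and "(\<Sum>e\<in>disc_edges q. \<alpha> e) \<le> 2 * pi - \<alpha> e - \<alpha> e'"
      using sum_angles_quad[OF q area] .
    then show ?thesis using pos[OF e(1)] pos[OF e(2)] by linarith
  qed
  obtain q0 where "q0 \<in> quad_types S" "s q0 > 0" using assms(5) by blast
  then have "(\<Sum>q\<in>quad_types S. s q * (2 * pi - (\<Sum>e\<in>disc_edges q. \<alpha> e))) > 0"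
    using assms(4) neg by (intro sum_pos2[of _ q0]) (auto simp: less_imp_le)
  then have "(\<Sum>q\<in>quad_types S. s q * ((\<Sum>e\<in>disc_edges q. \<alpha> e) - 2 * pi)) < 0"
    by (simp add: algebra_simps sum_subtractf)
  then have "2 * pi * (chi_star S \<Phi> s - chi_area_curvature S \<Phi> A \<kappa> s) < 0"
    unfolding Gauss_Bonnet[OF ac assms(3)] .
  then show ?thesis using pi_gt_zero by (simp add: mult_less_0_iff)
qed

end

theorem proposition17:
  fixes S :: "'a::euclidean_space set set" and \<Phi> :: "'a pairings"
    and A :: "'a disc \<Rightarrow> real" and \<kappa> :: "'a set set \<Rightarrow> real"
  assumes "pseudo_manifold S \<Phi>"
    and "\<forall>p\<in>triangle_types S. A p \<le> 0"
  shows "((\<exists>\<alpha>. semi_angle_structure S \<Phi> A \<kappa> \<alpha>) \<longrightarrow>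
           (\<forall>s\<in>solution_space S \<Phi>. (\<forall>q\<in>quad_types S. s q \<ge> 0) \<longrightarrow>
              chi_star S \<Phi> s \<le> chi_area_curvature S \<Phi> A \<kappa> s)) \<and>
         ((\<exists>\<alpha>. angle_structure S \<Phi> A \<kappa> \<alpha>) \<longrightarrow>
           (\<forall>s\<in>solution_space S \<Phi>. (\<forall>q\<in>quad_types S. s q \<ge> 0) \<longrightarrow> (\<exists>q\<in>quad_types S. s q > 0) \<longrightarrow>
              chi_star S \<Phi> s < chi_area_curvature S \<Phi> A \<kappa> s))"
proof -
  interpret triangulated_pseudo_manifold S \<Phi>
    by unfold_locales (rule assms(1))
  show ?thesis
    using chi_star_le_chi_area_curvature[OF _ assms(2)] chi_star_less_chi_area_curvature[OF _ assms(2)]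
    by blast
qed

end
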